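(* Let $k\in\mathbb{N}_0\cup\{\infty\}$, let $E,F$ be locally convex super vector spaces, $\mathcal{U}\subseteq\overline{E}^{(k)}$ an open subfunctor and $f\colon\mathcal{U}\to\overline{F}^{(k)}$ a natural transformation such that every $f_\Lambda$ is smooth. Let $n\le k$ and let $x=x_0+\sum_{I\in\mathcal{P}^n_+}x_I\in\mathcal{U}_{\Lambda_n}$ with $x_0\in\mathcal{U}_{\mathbb{R}}$ and $x_I\in\lambda_IE_{|I|\bmod 2}$. Then $$f_{\Lambda_n}(x)=f_{\Lambda_n}(x_0)+\sum_{I\in\mathcal{P}^n_+}\ \sum_{\omega\in\mathrm{Part}(I)}d^{\ell(\omega)}f_{\Lambda_n}(x_0)(x_{\omega_1},\dots,x_{\omega_{\ell(\omega)}}).$$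
   Context: $\mathcal{P}^n_+$ is the set of nonempty subsets of $\{1,\dots,n\}$. For a finite set $I$, $\mathrm{Part}(I)$ is the set of partitions $\omega=\{\omega_1,\dots,\omega_\ell\}$ of $I$ into nonempty pairwise disjoint subsets, $\ell(\omega)=\ell$ its length (order of the blocks is irrelevant since $d^\ell f$ is symmetric). Grassmann algebras $\Lambda_n=\mathbb{R}[\lambda_1..\lambda_n]$ (anticommuting generators, $\lambda_I=\lambda_{i_1}\cdots\lambda_{i_r}$ for $I=\{i_1<\dots<i_r\}$), category $\mathbf{Gr}^{(k)}$ of $\Lambda_0,\dots,\Lambda_k$ with parity-preserving unital homomorphisms. For a locally convex super vector space $E=E_0\oplus E_1$: $\overline{E}^{(k)}_\Lambda=(E_0\otimes\Lambda_{\bar0})\oplus(E_1\otimes\Lambda_{\bar1})=\prod_I\lambda_IE_{|I|\bmod2}$, functorial via $\mathrm{id}\otimes\varrho$, with $\overline{E}_{\mathbb{R}}=E_0\subseteq\overline{E}_{\Lambda_n}$. Open subfunctor: open sets $\mathcal{U}_\Lambda$ stable under the $\overline{E}^{(k)}_\varrho$. Smoothness is Bastiani smoothness, $d^\ell$ iterated directional derivatives. *)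

theory Defs
  imports "HOL-Analysis.Analysis" "HOL-Library.Disjoint_Sets" "HOL-Library.Extended_Nat"
begin

section \<open>Locally convex (Hausdorff) spaces\<close>

definition lcs :: "'a::{real_vector,t2_space} itself \<Rightarrow> bool" where
  "lcs _ \<longleftrightarrow>
     continuous_on UNIV (\<lambda>p::'a \<times> 'a. fst p + snd p) \<and>
     continuous_on UNIV (\<lambda>p::real \<times> 'a. fst p *\<^sub>R snd p) \<and>
     (\<forall>W::'a set. open W \<and> 0 \<in> W \<longrightarrow> (\<exists>C. open C \<and> convex C \<and> 0 \<in> C \<and> C \<subseteq> W))"

section \<open>Pointwise vector operations on function spaces\<close>

definition vadd :: "('i \<Rightarrow> 'a::real_vector) \<Rightarrow> ('i \<Rightarrow> 'a) \<Rightarrow> 'i \<Rightarrow> 'a" where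
  "vadd x y = (\<lambda>I. x I + y I)"
definition vsub :: "('i \<Rightarrow> 'a::real_vector) \<Rightarrow> ('i \<Rightarrow> 'a) \<Rightarrow> 'i \<Rightarrow> 'a" where
  "vsub x y = (\<lambda>I. x I - y I)"
definition vsc :: "real \<Rightarrow> ('i \<Rightarrow> 'a::real_vector) \<Rightarrow> 'i \<Rightarrow> 'a" where
  "vsc c x = (\<lambda>I. c *\<^sub>R x I)"

section \<open>Bastiani calculus (iterated directional derivatives)\<close>

text \<open>Directions are given as a sequence h :: nat => X; the l-th iterated derivative
  uses h 0, ..., h (l-1).  bder g l h x is d^l g(x)(h 0, ..., h (l-1)).\<close>

fun bder :: "(('i \<Rightarrow> 'a::real_vector) \<Rightarrow> ('j \<Rightarrow> 'b::{real_vector,topological_space}))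
    \<Rightarrow> nat \<Rightarrow> (nat \<Rightarrow> 'i \<Rightarrow> 'a) \<Rightarrow> ('i \<Rightarrow> 'a) \<Rightarrow> ('j \<Rightarrow> 'b)" where
  "bder g 0 h x = g x"
| "bder g (Suc l) h x =
     (THE v. ((\<lambda>t::real. vsc (1 / t) (vsub (bder g l h (vadd x (vsc t (h l)))) (bder g l h x)))
               \<longlongrightarrow> v) (at 0))"

definition dirs :: "('i \<Rightarrow> 'a::real_vector) set \<Rightarrow> nat \<Rightarrow> (nat \<Rightarrow> 'i \<Rightarrow> 'a) set" where
  "dirs S l = {h. (\<forall>i<l. h i \<in> S) \<and> (\<forall>i\<ge>l. h i = (\<lambda>_. 0))}"

text \<open>Bastiani smoothness of g on U, where U is an open subset of the (linear subspace) S
  with the subspace topology: all iterated directional derivatives exist and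
  (x, h_1..h_l) |-> d^l g(x)(h_1..h_l) is continuous on U x S^l.\<close>

definition bsmooth :: "('i \<Rightarrow> 'a::{real_vector,topological_space}) set \<Rightarrow> ('i \<Rightarrow> 'a) set
    \<Rightarrow> (('i \<Rightarrow> 'a) \<Rightarrow> ('j \<Rightarrow> 'b::{real_vector,topological_space})) \<Rightarrow> bool" where
  "bsmooth S U g \<longleftrightarrow> U \<subseteq> S \<and>
     (\<forall>l. (\<forall>x\<in>U. \<forall>h\<in>dirs S (Suc l).
             ((\<lambda>t::real. vsc (1 / t) (vsub (bder g l h (vadd x (vsc t (h l)))) (bder g l h x)))
               \<longlongrightarrow> bder g (Suc l) h x) (at 0)) \<and>
          continuous_on (U \<times> dirs S l) (\<lambda>p. bder g l (snd p) (fst p)))"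

section \<open>Grassmann algebras Lambda_n\<close>

text \<open>An element of Lambda_n is its coefficient family (a_I), I subset of {1..n}.\<close>

definition grass :: "nat \<Rightarrow> (nat set \<Rightarrow> real) set" where
  "grass n = {a. \<forall>I. \<not> I \<subseteq> {1..n} \<longrightarrow> a I = 0}"

definition gb :: "nat set \<Rightarrow> nat set \<Rightarrow> real" where
  "gb I = (\<lambda>J. if J = I then 1 else 0)"

definition gone :: "nat set \<Rightarrow> real" where
  "gone = gb {}"

text \<open>lambda_I lambda_J = gsign I J lambda_(I union J) for disjoint I, J.\<close>
definition gsign :: "nat set \<Rightarrow> nat set \<Rightarrow> real" where
  "gsign I J = (-1) ^ card {(i, j). i \<in> I \<and> j \<in> J \<and> j < i}"

definition gmul :: "(nat set \<Rightarrow> real) \<Rightarrow> (nat set \<Rightarrow> real) \<Rightarrow> nat set \<Rightarrow> real" where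
  "gmul a b = (\<lambda>K. \<Sum>I\<in>Pow K. gsign I (K - I) * a I * b (K - I))"

definition geven :: "nat \<Rightarrow> (nat set \<Rightarrow> real) set" where
  "geven n = {a \<in> grass n. \<forall>I. odd (card I) \<longrightarrow> a I = 0}"

definition godd :: "nat \<Rightarrow> (nat set \<Rightarrow> real) set" where
  "godd n = {a \<in> grass n. \<forall>I. even (card I) \<longrightarrow> a I = 0}"

text \<open>Morphisms Lambda_n -> Lambda_m of Gr: parity-preserving unital algebra homomorphisms.\<close>
definition ghom :: "nat \<Rightarrow> nat \<Rightarrow> ((nat set \<Rightarrow> real) \<Rightarrow> (nat set \<Rightarrow> real)) \<Rightarrow> bool" where
  "ghom n m \<rho> \<longleftrightarrow>
     (\<forall>a\<in>grass n. \<rho> a \<in> grass m) \<and>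
     (\<forall>a\<in>grass n. \<forall>b\<in>grass n. \<rho> (vadd a b) = vadd (\<rho> a) (\<rho> b)) \<and>
     (\<forall>c. \<forall>a\<in>grass n. \<rho> (vsc c a) = vsc c (\<rho> a)) \<and>
     (\<forall>a\<in>grass n. \<forall>b\<in>grass n. \<rho> (gmul a b) = gmul (\<rho> a) (\<rho> b)) \<and>
     \<rho> gone = gone \<and>
     (\<forall>a\<in>geven n. \<rho> a \<in> geven m) \<and>
     (\<forall>a\<in>godd n. \<rho> a \<in> godd m)"

section \<open>The functor E-bar for a super vector space E = E_0 (+) E_1\<close>

text \<open>E-bar_(Lambda_n) = prod_I lambda_I E_(|I| mod 2), an element being the family (x_I),
  with x_I in E_0 x {0} for |I| even and in {0} x E_1 for |I| odd.\<close>

definition sbar :: "nat \<Rightarrow> (nat set \<Rightarrow> ('a::zero) \<times> ('b::zero)) set" where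
  "sbar n = {x. \<forall>I. (\<not> I \<subseteq> {1..n} \<longrightarrow> x I = 0) \<and>
                    (even (card I) \<longrightarrow> snd (x I) = 0) \<and>
                    (odd (card I) \<longrightarrow> fst (x I) = 0)}"

text \<open>E-bar_rho = id tensor rho.\<close>
definition barmap :: "nat \<Rightarrow> ((nat set \<Rightarrow> real) \<Rightarrow> (nat set \<Rightarrow> real))
    \<Rightarrow> (nat set \<Rightarrow> ('a::real_vector) \<times> ('b::real_vector)) \<Rightarrow> nat set \<Rightarrow> 'a \<times> 'b" where
  "barmap n \<rho> x = (\<lambda>J. \<Sum>I\<in>Pow {1..n}. \<rho> (gb I) J *\<^sub>R x I)"

text \<open>Open subfunctor of E-bar^(k) (objects Lambda_0..Lambda_k, k possibly infinite).\<close>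
definition open_subfunctor :: "enat \<Rightarrow> (nat \<Rightarrow> (nat set \<Rightarrow> ('a::{real_vector,topological_space}) \<times> ('b::{real_vector,topological_space})) set) \<Rightarrow> bool" where
  "open_subfunctor k U \<longleftrightarrow>
     (\<forall>n. enat n \<le> k \<longrightarrow> U n \<subseteq> sbar n \<and> openin (top_of_set (sbar n)) (U n)) \<and>
     (\<forall>n m \<rho>. enat n \<le> k \<longrightarrow> enat m \<le> k \<longrightarrow> ghom n m \<rho> \<longrightarrow> barmap n \<rho> ` U n \<subseteq> U m)"

text \<open>Natural transformation f : U -> F-bar^(k).\<close>
definition nat_trans :: "enat \<Rightarrow> (nat \<Rightarrow> (nat set \<Rightarrow> ('a::real_vector) \<times> ('b::real_vector)) set)
    \<Rightarrow> (nat \<Rightarrow> (nat set \<Rightarrow> 'a \<times> 'b) \<Rightarrow> (nat set \<Rightarrow> ('c::real_vector) \<times> ('d::real_vector))) \<Rightarrow> bool" where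
  "nat_trans k U f \<longleftrightarrow>
     (\<forall>n. enat n \<le> k \<longrightarrow> (\<forall>x\<in>U n. f n x \<in> sbar n)) \<and>
     (\<forall>n m \<rho> x. enat n \<le> k \<longrightarrow> enat m \<le> k \<longrightarrow> ghom n m \<rho> \<longrightarrow> x \<in> U n \<longrightarrow>
        f m (barmap n \<rho> x) = barmap n \<rho> (f n x))"

section \<open>Components of x\<close>

definition comp0 :: "(nat set \<Rightarrow> 'a::zero) \<Rightarrow> nat set \<Rightarrow> 'a" where
  "comp0 x = (\<lambda>J. if J = {} then x {} else 0)"

definition compI :: "(nat set \<Rightarrow> 'a::zero) \<Rightarrow> nat set \<Rightarrow> nat set \<Rightarrow> 'a" where
  "compI x I = (\<lambda>J. if J = I then x I else 0)"

text \<open>Directions (x_omega_1, ..., x_omega_l) for a partition omega, blocks in an arbitrary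
  (fixed) order -- irrelevant since d^l f is symmetric.\<close>
definition blockdirs :: "(nat set \<Rightarrow> 'a::zero) \<Rightarrow> nat set set \<Rightarrow> nat \<Rightarrow> nat set \<Rightarrow> 'a" where
  "blockdirs x \<omega> = (let bs = (SOME bs. distinct bs \<and> set bs = \<omega>)
                    in (\<lambda>i. if i < length bs then compI x (bs ! i) else (\<lambda>_. 0)))"

end

theory Submission
  imports Defs
begin

(* The scalings lambda_i |-> s_i lambda_i of the Grassmann algebra are morphisms
   of Gr, so by naturality f_Lambda and all its derivatives commute with the induced maps on
   E-bar and F-bar.  Put x_t = x_0 + sum_K t_K x_K.  Rescaling a single generator i by sigma
   and letting sigma -> 0 shows that a derivative of f at x_t in directions x_K1, ..., x_Kl
   vanishes as soon as i lies in two of the K_j.  Hence t |-> f(x_t) has vanishing second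
   derivative in each t_K, so (mean value theorem in a locally convex space) it is affine in
   each t_K near 0; it then has symmetric mixed derivatives and equals its multi-affine Taylor
   expansion at t = 0.  Homogeneity in each generator leaves, in the lambda_J-component, only
   the terms whose blocks partition J.  Finally, t_K = eps^|K| corresponds to rescaling x by
   eps, which gives every partition of J the common weight eps^|J|. *)

section \<open>Locally convex spaces\<close>

lemma lcs_tendsto_add:
  fixes u v :: "'z \<Rightarrow> 'a::{real_vector,t2_space}"
  assumes "lcs TYPE('a)" "(u \<longlongrightarrow> u0) F" "(v \<longlongrightarrow> v0) F"
  shows "((\<lambda>z. u z + v z) \<longlongrightarrow> u0 + v0) F"
proof -
  have "isCont (\<lambda>p::'a \<times> 'a. fst p + snd p) (u0, v0)"
    using assms(1) continuous_on_eq_continuous_at unfolding lcs_def by blast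
  from isCont_tendsto_compose[OF this tendsto_Pair[OF assms(2,3)]] show ?thesis by simp
qed

lemma lcs_tendsto_scaleR:
  fixes v :: "'z \<Rightarrow> 'a::{real_vector,t2_space}"
  assumes "lcs TYPE('a)" "(c \<longlongrightarrow> c0) F" "(v \<longlongrightarrow> v0) F"
  shows "((\<lambda>z. c z *\<^sub>R v z) \<longlongrightarrow> c0 *\<^sub>R v0) F"
proof -
  have "isCont (\<lambda>p::real \<times> 'a. fst p *\<^sub>R snd p) (c0, v0)"
    using assms(1) continuous_on_eq_continuous_at unfolding lcs_def by blast
  from isCont_tendsto_compose[OF this tendsto_Pair[OF assms(2,3)]] show ?thesis by simp
qed

lemma lcs_prod:
  assumes A: "lcs TYPE('a::{real_vector,t2_space})" and B: "lcs TYPE('b::{real_vector,t2_space})"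
  shows "lcs TYPE('a \<times> 'b)"
  unfolding lcs_def
proof (intro conjI allI impI)
  show "continuous_on UNIV (\<lambda>p::('a \<times> 'b) \<times> ('a \<times> 'b). fst p + snd p)"
    unfolding continuous_on_def plus_prod_def
    by (intro ballI tendsto_Pair lcs_tendsto_add[OF A] lcs_tendsto_add[OF B]
          tendsto_fst tendsto_snd tendsto_ident_at)
  show "continuous_on UNIV (\<lambda>p::real \<times> ('a \<times> 'b). fst p *\<^sub>R snd p)"
    unfolding continuous_on_def scaleR_prod_def
    by (intro ballI tendsto_Pair lcs_tendsto_scaleR[OF A] lcs_tendsto_scaleR[OF B]
          tendsto_fst tendsto_snd tendsto_ident_at)
next
  fix W :: "('a \<times> 'b) set"
  assume "open W \<and> 0 \<in> W"
  then obtain S T where ST: "open S" "open T" "0 \<in> S" "0 \<in> T" "S \<times> T \<subseteq> W"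
    unfolding open_prod_def zero_prod_def by blast
  obtain C where "open C" "convex C" "0 \<in> C" "C \<subseteq> S" using A ST unfolding lcs_def by blast
  moreover obtain D where "open D" "convex D" "0 \<in> D" "D \<subseteq> T" using B ST unfolding lcs_def by blast
  ultimately show "\<exists>C. open C \<and> convex C \<and> 0 \<in> C \<and> C \<subseteq> W"
    using ST by (intro exI[of _ "C \<times> D"]) (auto simp: open_Times convex_Times zero_prod_def)
qed

lemma real_interval_induct:
  fixes a b :: real
  assumes "a \<le> b" and base: "P a"
    and left: "\<And>s. a < s \<Longrightarrow> s \<le> b \<Longrightarrow> (\<And>s'. a \<le> s' \<Longrightarrow> s' < s \<Longrightarrow> P s') \<Longrightarrow> P s"
    and right: "\<And>s. a \<le> s \<Longrightarrow> s < b \<Longrightarrow> P s \<Longrightarrow> \<exists>\<epsilon>>0. \<forall>h. 0 < h \<and> h < \<epsilon> \<longrightarrow> P (s + h)"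
  shows "P b"
proof -
  define T where "T = {s \<in> {a..b}. \<forall>s'\<in>{a..s}. P s'}"
  define \<sigma> where "\<sigma> = Sup T"
  have aT: "a \<in> T" using assms(1) base by (auto simp: T_def)
  have bdd: "bdd_above T" by (rule bdd_aboveI[of _ b]) (auto simp: T_def)
  have a\<sigma>: "a \<le> \<sigma>" unfolding \<sigma>_def using aT bdd by (rule cSup_upper)
  have \<sigma>b: "\<sigma> \<le> b" unfolding \<sigma>_def using aT by (intro cSup_least) (auto simp: T_def)
  have below: "P s'" if s': "a \<le> s'" "s' < \<sigma>" for s'
  proof -
    obtain s where "s \<in> T" "s' < s" using s' less_cSup_iff[of T s'] aT bdd unfolding \<sigma>_def by auto
    then show ?thesis using s' by (auto simp: T_def)
  qed
  have P\<sigma>: "P \<sigma>"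
    using base below left[OF _ \<sigma>b] a\<sigma> by (cases "\<sigma> = a") auto
  have \<sigma>T: "\<sigma> \<in> T" using a\<sigma> \<sigma>b below P\<sigma> by (auto simp: T_def order.order_iff_strict)
  show "P b"
  proof (cases "\<sigma> = b")
    case False
    then obtain \<epsilon> where \<epsilon>: "\<epsilon> > 0" "\<And>h. 0 < h \<Longrightarrow> h < \<epsilon> \<Longrightarrow> P (\<sigma> + h)"
      using right[OF a\<sigma> _ P\<sigma>] \<sigma>b by force
    define h where "h = min (\<epsilon> / 2) (b - \<sigma>)"
    have h: "0 < h" "h < \<epsilon>" "\<sigma> + h \<le> b" using \<epsilon> False \<sigma>b by (auto simp: h_def min_def)
    have "\<sigma> + h \<in> T"
      unfolding T_def
    proof (intro CollectI conjI ballI)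
      fix s' assume s': "s' \<in> {a..\<sigma> + h}"
      show "P s'"
      proof (cases "s' \<le> \<sigma>")
        case False
        then show ?thesis using \<epsilon>(2)[of "s' - \<sigma>"] s' h by auto
      qed (use \<sigma>T s' in \<open>auto simp: T_def\<close>)
    qed (use h a\<sigma> in auto)
    then have "\<sigma> + h \<le> \<sigma>" unfolding \<sigma>_def using bdd by (rule cSup_upper)
    then show ?thesis using h by simp
  qed (use P\<sigma> in simp)
qed

lemma convex_scaled_add:
  assumes "convex C" "0 < \<alpha>" "0 < \<beta>" "u \<in> (*\<^sub>R) \<alpha> ` C" "v \<in> (*\<^sub>R) \<beta> ` C"
  shows "u + v \<in> (*\<^sub>R) (\<alpha> + \<beta>) ` C"
proof -
  obtain c d where cd: "c \<in> C" "d \<in> C" "u = \<alpha> *\<^sub>R c" "v = \<beta> *\<^sub>R d" using assms(4,5) by blast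
  have "(\<alpha> / (\<alpha> + \<beta>)) *\<^sub>R c + (\<beta> / (\<alpha> + \<beta>)) *\<^sub>R d \<in> C"
    using assms(1-3) cd unfolding convex_def by (auto simp: add_divide_distrib[symmetric])
  moreover have "u + v = (\<alpha> + \<beta>) *\<^sub>R ((\<alpha> / (\<alpha> + \<beta>)) *\<^sub>R c + (\<beta> / (\<alpha> + \<beta>)) *\<^sub>R d)"
    using assms(2,3) cd by (simp add: scaleR_add_right)
  ultimately show ?thesis by blast
qed

lemma convex_scaled_mono:
  assumes "convex C" "0 \<in> C" "0 < \<alpha>" "\<alpha> \<le> \<beta>" "u \<in> (*\<^sub>R) \<alpha> ` C"
  shows "u \<in> (*\<^sub>R) \<beta> ` C"
proof -
  obtain c where c: "c \<in> C" "u = \<alpha> *\<^sub>R c" using assms(5) by blast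
  have "(\<alpha> / \<beta>) *\<^sub>R c + (1 - \<alpha> / \<beta>) *\<^sub>R 0 \<in> C"
    by (rule convexD[OF assms(1) c(1) assms(2)]) (use assms(3,4) in auto)
  moreover have "u = \<beta> *\<^sub>R ((\<alpha> / \<beta>) *\<^sub>R c + (1 - \<alpha> / \<beta>) *\<^sub>R 0)" using assms(3,4) c by simp
  ultimately show ?thesis by blast
qed

lemma lcs_small_increments:
  fixes \<phi> :: "real \<Rightarrow> 'a::{real_vector,t2_space}"
  assumes "lcs TYPE('a)" "open C" "0 \<in> C" "0 < \<mu>"
    and "((\<lambda>h. (1 / h) *\<^sub>R (\<phi> (r + h) - \<phi> r)) \<longlongrightarrow> 0) (at 0)"
  shows "\<exists>\<epsilon>>0. \<forall>h. 0 < h \<and> h < \<epsilon> \<longrightarrow>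
           \<phi> (r + h) - \<phi> r \<in> (*\<^sub>R) (h * \<mu>) ` C \<and> \<phi> r - \<phi> (r - h) \<in> (*\<^sub>R) (h * \<mu>) ` C"
proof -
  have "((\<lambda>h. (1 / \<mu>) *\<^sub>R ((1 / h) *\<^sub>R (\<phi> (r + h) - \<phi> r))) \<longlongrightarrow> (1 / \<mu>) *\<^sub>R 0) (at 0)"
    by (rule lcs_tendsto_scaleR[OF assms(1) tendsto_const assms(5)])
  then have "eventually (\<lambda>h. (1 / \<mu>) *\<^sub>R ((1 / h) *\<^sub>R (\<phi> (r + h) - \<phi> r)) \<in> C) (at 0)"
    using assms(2,3) by (auto dest: topological_tendstoD)
  then obtain \<epsilon> where \<epsilon>: "\<epsilon> > 0"
    "\<And>h. h \<noteq> 0 \<Longrightarrow> \<bar>h\<bar> < \<epsilon> \<Longrightarrow> (1 / \<mu>) *\<^sub>R ((1 / h) *\<^sub>R (\<phi> (r + h) - \<phi> r)) \<in> C"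
    unfolding eventually_at by (auto simp: dist_real_def)
  define q where "q h = (1 / \<mu>) *\<^sub>R ((1 / h) *\<^sub>R (\<phi> (r + h) - \<phi> r))" for h
  have "\<phi> (r + h) - \<phi> r = (h * \<mu>) *\<^sub>R q h" "\<phi> r - \<phi> (r - h) = (h * \<mu>) *\<^sub>R q (- h)"
    if "h \<noteq> 0" for h
    using that assms(4) by (simp_all add: q_def algebra_simps)
  moreover have "q h \<in> C" "q (- h) \<in> C" if "0 < h" "h < \<epsilon>" for h
    using that \<epsilon>(2)[of h] \<epsilon>(2)[of "- h"] by (simp_all add: q_def)
  ultimately have "\<forall>h. 0 < h \<and> h < \<epsilon> \<longrightarrow>
           \<phi> (r + h) - \<phi> r \<in> (*\<^sub>R) (h * \<mu>) ` C \<and> \<phi> r - \<phi> (r - h) \<in> (*\<^sub>R) (h * \<mu>) ` C"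
    by auto
  with \<epsilon>(1) show ?thesis by blast
qed

lemma lcs_derivative_zero_imp_const:
  fixes \<phi> :: "real \<Rightarrow> 'a::{real_vector,t2_space}"
  assumes lcs: "lcs TYPE('a)" and "a \<le> b"
    and der: "\<And>r. r \<in> {a..b} \<Longrightarrow> ((\<lambda>h. (1 / h) *\<^sub>R (\<phi> (r + h) - \<phi> r)) \<longlongrightarrow> 0) (at 0)"
  shows "\<phi> b = \<phi> a"
proof (rule ccontr)
  assume "\<phi> b \<noteq> \<phi> a"
  then obtain V W where VW: "open V" "open W" "\<phi> b - \<phi> a \<in> V" "0 \<in> W" "V \<inter> W = {}"
    using hausdorff[of "\<phi> b - \<phi> a" 0] by auto
  obtain C where C: "open C" "convex C" "0 \<in> C" "C \<subseteq> W"
    using lcs VW unfolding lcs_def by blast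
  define \<mu> where "\<mu> = 1 / (2 * (b - a + 1))"
  have \<mu>: "0 < \<mu>" "\<mu> * (b - a) \<le> 1 / 2" using \<open>a \<le> b\<close> by (auto simp: \<mu>_def field_simps)
  have pos: "0 < \<mu> * (s - a) + 1 / 2" if "a \<le> s" for s
    using \<mu>(1) that by (intro add_nonneg_pos mult_nonneg_nonneg) auto
  \<comment> \<open>The increments, creeping along [a, b], stay in a multiple at most 1 of C, which misses
      \<phi> b - \<phi> a.\<close>
  have "\<phi> b - \<phi> a \<in> (*\<^sub>R) (\<mu> * (b - a) + 1 / 2) ` C" (is "?P b")
  proof (rule real_interval_induct[of a b ?P])
    have "\<phi> a - \<phi> a = (\<mu> * (a - a) + 1 / 2) *\<^sub>R 0" by simp
    with C(3) show "?P a" by blast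
  next
    fix s assume left: "a < s" "s \<le> b" "\<And>s'. a \<le> s' \<Longrightarrow> s' < s \<Longrightarrow> ?P s'"
    obtain \<epsilon> where "\<epsilon> > 0" and \<epsilon>: "\<And>h. 0 < h \<Longrightarrow> h < \<epsilon> \<Longrightarrow> \<phi> s - \<phi> (s - h) \<in> (*\<^sub>R) (h * \<mu>) ` C"
      using lcs_small_increments[OF lcs C(1,3) \<mu>(1) der[of s]] left(1,2) by auto
    define h where "h = min (\<epsilon> / 2) ((s - a) / 2)"
    have h: "0 < h" "h < \<epsilon>" "a \<le> s - h" "s - h < s" using \<open>\<epsilon> > 0\<close> left by (auto simp: h_def min_def field_simps)
    have "(\<phi> (s - h) - \<phi> a) + (\<phi> s - \<phi> (s - h)) \<in> (*\<^sub>R) ((\<mu> * (s - h - a) + 1 / 2) + h * \<mu>) ` C"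
      using convex_scaled_add[OF C(2) pos[OF h(3)] mult_pos_pos[OF h(1) \<mu>(1)] left(3)[OF h(3,4)] \<epsilon>[OF h(1,2)]] .
    moreover have "(\<mu> * (s - h - a) + 1 / 2) + h * \<mu> = \<mu> * (s - a) + 1 / 2"
      by (simp add: algebra_simps)
    ultimately show "?P s" by simp
  next
    fix s assume right: "a \<le> s" "s < b" "?P s"
    obtain \<epsilon> where "\<epsilon> > 0" and \<epsilon>: "\<And>h. 0 < h \<Longrightarrow> h < \<epsilon> \<Longrightarrow> \<phi> (s + h) - \<phi> s \<in> (*\<^sub>R) (h * \<mu>) ` C"
      using lcs_small_increments[OF lcs C(1,3) \<mu>(1) der[of s]] right(1,2) by auto
    have "\<phi> (s + h) - \<phi> a \<in> (*\<^sub>R) (\<mu> * (s + h - a) + 1 / 2) ` C" if "0 < h" "h < \<epsilon>" for h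
    proof -
      have "(\<phi> s - \<phi> a) + (\<phi> (s + h) - \<phi> s) \<in> (*\<^sub>R) ((\<mu> * (s - a) + 1 / 2) + h * \<mu>) ` C"
        using convex_scaled_add[OF C(2) pos[OF right(1)] mult_pos_pos[OF that(1) \<mu>(1)] right(3) \<epsilon>[OF that]] .
      moreover have "(\<mu> * (s - a) + 1 / 2) + h * \<mu> = \<mu> * (s + h - a) + 1 / 2"
        by (simp add: algebra_simps)
      ultimately show ?thesis by simp
    qed
    with \<open>\<epsilon> > 0\<close> show "\<exists>\<epsilon>>0. \<forall>h. 0 < h \<and> h < \<epsilon> \<longrightarrow> ?P (s + h)" by blast
  qed (rule \<open>a \<le> b\<close>)
  moreover have "\<mu> * (b - a) + 1 / 2 \<le> 1" using \<mu>(2) by simp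
  ultimately have "\<phi> b - \<phi> a \<in> (*\<^sub>R) 1 ` C"
    using convex_scaled_mono[OF C(2,3) pos[OF \<open>a \<le> b\<close>]] by blast
  then have "\<phi> b - \<phi> a \<in> W" using C(4) by auto
  then show False using VW by blast
qed

lemma lcs_derivative_const_imp_affine:
  fixes \<phi> :: "real \<Rightarrow> 'a::{real_vector,t2_space}"
  assumes lcs: "lcs TYPE('a)" and "a \<le> b"
    and der: "\<And>r. r \<in> {a..b} \<Longrightarrow> ((\<lambda>h. (1 / h) *\<^sub>R (\<phi> (r + h) - \<phi> r)) \<longlongrightarrow> c) (at 0)"
  shows "\<phi> b = \<phi> a + (b - a) *\<^sub>R c"
proof -
  define \<psi> where "\<psi> r = \<phi> r - r *\<^sub>R c" for r
  have "((\<lambda>h. (1 / h) *\<^sub>R (\<psi> (r + h) - \<psi> r)) \<longlongrightarrow> 0) (at 0)" if "r \<in> {a..b}" for r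
  proof -
    have "((\<lambda>h. (1 / h) *\<^sub>R (\<phi> (r + h) - \<phi> r) + (- 1) *\<^sub>R c) \<longlongrightarrow> c + (- 1) *\<^sub>R c) (at 0)"
      by (intro lcs_tendsto_add[OF lcs der[OF that]] tendsto_const)
    moreover have "eventually (\<lambda>h. (1 / h) *\<^sub>R (\<phi> (r + h) - \<phi> r) + (- 1) *\<^sub>R c
                      = (1 / h) *\<^sub>R (\<psi> (r + h) - \<psi> r)) (at 0)"
      unfolding eventually_at by (intro exI[of _ 1]) (auto simp: \<psi>_def algebra_simps)
    ultimately show ?thesis by (simp add: tendsto_cong)
  qed
  then have "\<psi> b = \<psi> a" by (rule lcs_derivative_zero_imp_const[OF lcs \<open>a \<le> b\<close>])
  then show ?thesis by (simp add: \<psi>_def algebra_simps)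
qed

section \<open>Function spaces and iterated directional derivatives\<close>

lemma tendsto_fun_iff:
  fixes f :: "'z \<Rightarrow> 'i \<Rightarrow> 'b::topological_space"
  shows "(f \<longlongrightarrow> l) F \<longleftrightarrow> (\<forall>i. ((\<lambda>z. f z i) \<longlongrightarrow> l i) F)"
proof -
  have "(f \<longlongrightarrow> l) F \<longleftrightarrow> limitin (product_topology (\<lambda>i. euclidean) UNIV) f l F"
    by (simp add: euclidean_product_topology)
  also have "\<dots> \<longleftrightarrow> (\<forall>i. ((\<lambda>z. f z i) \<longlongrightarrow> l i) F)"
    by (simp add: limitin_componentwise)
  finally show ?thesis .
qed

lemma tendsto_fun_unique:
  fixes f :: "'z \<Rightarrow> 'i \<Rightarrow> 'b::t2_space"
  assumes "F \<noteq> bot" "(f \<longlongrightarrow> a) F" "(f \<longlongrightarrow> b) F"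
  shows "a = b"
proof
  fix i
  from assms(2,3) have "((\<lambda>z. f z i) \<longlongrightarrow> a i) F" "((\<lambda>z. f z i) \<longlongrightarrow> b i) F"
    by (auto simp: tendsto_fun_iff)
  then show "a i = b i" using tendsto_unique assms(1) by blast
qed

lemma openin_fun_contains_box:
  fixes U S :: "('i \<Rightarrow> 'a::topological_space) set"
  assumes "openin (top_of_set S) U" "q \<in> U"
  obtains X where "\<And>c. open (X c)" "finite {c. X c \<noteq> UNIV}" "\<And>c. q c \<in> X c"
    "\<And>y. y \<in> S \<Longrightarrow> (\<And>c. y c \<in> X c) \<Longrightarrow> y \<in> U"
proof -
  obtain V where V: "open V" "U = S \<inter> V" using assms(1) by (auto simp: openin_open)
  then have "openin (product_topology (\<lambda>i. euclidean) UNIV) V" "q \<in> V"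
    using assms(2) by (auto simp: open_fun_def)
  from product_topology_open_contains_basis[OF this] obtain X where
    "q \<in> (\<Pi>\<^sub>E i\<in>UNIV. X i)" "\<forall>i. openin euclidean (X i)" "finite {i. X i \<noteq> topspace euclidean}"
    "(\<Pi>\<^sub>E i\<in>UNIV. X i) \<subseteq> V" by blast
  with V show ?thesis by (intro that[of X]) (auto simp: PiE_UNIV_domain)
qed

lemma openin_eventually_in:
  assumes "openin (top_of_set S) U" "(p \<longlongrightarrow> q) F" "q \<in> U" "eventually (\<lambda>r. p r \<in> S) F"
  shows "eventually (\<lambda>r. p r \<in> U) F"
proof -
  obtain V where V: "open V" "U = S \<inter> V" using assms(1) by (auto simp: openin_open)
  then have "eventually (\<lambda>r. p r \<in> V) F" using assms(2,3) by (auto dest: topological_tendstoD)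
  with assms(4) show ?thesis unfolding V(2) by (auto elim: eventually_elim2)
qed

lemma filterlim_mult_const_at_0: "(c::real) \<noteq> 0 \<Longrightarrow> filterlim (\<lambda>r. r * c) (at 0) (at 0)"
  unfolding filterlim_at by (auto intro!: tendsto_eq_intros simp: eventually_at_filter)

lemma bder_cong:
  "(\<And>i. i < l \<Longrightarrow> h i = h' i) \<Longrightarrow> bder g l h x = bder g l h' x"
proof (induction l arbitrary: x)
  case (Suc l)
  then have "bder g l h = bder g l h'" "h l = h' l" by auto
  then show ?case by simp
qed simp

lemma bsmooth_tendsto_bder:
  assumes "bsmooth S U g" "x \<in> U" "\<And>i. i \<le> l \<Longrightarrow> h i \<in> S"
  shows "((\<lambda>t::real. vsc (1 / t) (vsub (bder g l h (vadd x (vsc t (h l)))) (bder g l h x)))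
           \<longlongrightarrow> bder g (Suc l) h x) (at 0)"
proof -
  define h' where "h' i = (if i \<le> l then h i else (\<lambda>_. 0))" for i
  have "h' \<in> dirs S (Suc l)" using assms(3) by (auto simp: dirs_def h'_def)
  then have "((\<lambda>t::real. vsc (1 / t) (vsub (bder g l h' (vadd x (vsc t (h' l)))) (bder g l h' x)))
               \<longlongrightarrow> bder g (Suc l) h' x) (at 0)" using assms(1,2) unfolding bsmooth_def by blast
  moreover have "bder g (Suc l) h' x = bder g (Suc l) h x"
    by (rule bder_cong) (simp add: h'_def)
  moreover have "bder g l h' = bder g l h" "h' l = h l"
    by (auto intro!: bder_cong simp: h'_def)
  ultimately show ?thesis by (simp del: bder.simps)
qed

lemma bder_unique:
  fixes g :: "('i \<Rightarrow> 'a::real_vector) \<Rightarrow> 'j \<Rightarrow> 'b::{real_vector,t2_space}"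
  assumes "((\<lambda>t::real. vsc (1 / t) (vsub (bder g l h (vadd x (vsc t (h l)))) (bder g l h x))) \<longlongrightarrow> v) (at 0)"
  shows "bder g (Suc l) h x = v"
  by (simp only: bder.simps)
     (rule the_equality, rule assms, rule tendsto_fun_unique[OF at_neq_bot _ assms])

lemma sbar_add_scale: "y \<in> sbar n \<Longrightarrow> z \<in> sbar n \<Longrightarrow> vadd y (vsc r z) \<in> sbar n"
  by (auto simp: sbar_def vadd_def vsc_def)

section \<open>Rescaling the generators\<close>

definition grass_scale :: "(nat \<Rightarrow> real) \<Rightarrow> (nat set \<Rightarrow> real) \<Rightarrow> nat set \<Rightarrow> real" where
  "grass_scale s a = (\<lambda>J. (\<Prod>i\<in>J. s i) * a J)"

definition bar_scale :: "nat \<Rightarrow> (nat \<Rightarrow> real) \<Rightarrow> (nat set \<Rightarrow> 'a::real_vector) \<Rightarrow> nat set \<Rightarrow> 'a" where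
  "bar_scale n s y = (\<lambda>J. if J \<subseteq> {1..n} then (\<Prod>i\<in>J. s i) *\<^sub>R y J else 0)"

lemma grass_scale_gmul: "grass_scale s (gmul a b) = gmul (grass_scale s a) (grass_scale s b)"
proof
  fix K
  show "grass_scale s (gmul a b) K = gmul (grass_scale s a) (grass_scale s b) K"
  proof (cases "finite K")
    case True
    have "(\<Prod>i\<in>K. s i) = (\<Prod>i\<in>K - I. s i) * (\<Prod>i\<in>I. s i)" if "I \<subseteq> K" for I
      using True that by (intro prod.subset_diff) auto
    then show ?thesis
      unfolding grass_scale_def gmul_def sum_distrib_left by (intro sum.cong) (auto simp: algebra_simps)
  qed (simp add: grass_scale_def gmul_def)
qed

lemma ghom_grass_scale: "ghom n n (grass_scale s)"
  unfolding ghom_def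
  by (intro conjI ballI allI grass_scale_gmul)
     (auto simp: grass_def geven_def godd_def grass_scale_def vadd_def vsc_def
                 gone_def gb_def algebra_simps)

lemma barmap_grass_scale: "barmap n (grass_scale s) y = bar_scale n s y"
proof
  fix J
  have "barmap n (grass_scale s) y J = (\<Sum>I\<in>Pow {1..n}. if I = J then (\<Prod>i\<in>J. s i) *\<^sub>R y J else 0)"
    unfolding barmap_def grass_scale_def gb_def by (intro sum.cong) auto
  then show "barmap n (grass_scale s) y J = bar_scale n s y J" by (simp add: bar_scale_def)
qed

lemma bar_scale_vadd: "bar_scale n s (vadd a b) = vadd (bar_scale n s a) (bar_scale n s b)"
  by (auto simp: bar_scale_def vadd_def scaleR_add_right)

lemma bar_scale_vsc: "bar_scale n s (vsc c a) = vsc c (bar_scale n s a)"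
  by (auto simp: bar_scale_def vsc_def)

lemma bar_scale_vsub: "bar_scale n s (vsub a b) = vsub (bar_scale n s a) (bar_scale n s b)"
  by (auto simp: bar_scale_def vsub_def scaleR_diff_right)

lemma tendsto_bar_scale:
  fixes Q :: "'z \<Rightarrow> nat set \<Rightarrow> 'a::{real_vector,t2_space}"
  assumes "lcs TYPE('a)" "(Q \<longlongrightarrow> L) F"
  shows "((\<lambda>r. bar_scale n s (Q r)) \<longlongrightarrow> bar_scale n s L) F"
  using assms by (auto simp: tendsto_fun_iff bar_scale_def intro!: lcs_tendsto_scaleR)

lemma tendsto_vsc:
  fixes Q :: "'z \<Rightarrow> 'i \<Rightarrow> 'a::{real_vector,t2_space}"
  assumes "lcs TYPE('a)" "(Q \<longlongrightarrow> L) F"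
  shows "((\<lambda>r. vsc c (Q r)) \<longlongrightarrow> vsc c L) F"
  using assms by (auto simp: tendsto_fun_iff vsc_def intro!: lcs_tendsto_scaleR)

section \<open>Lists of blocks\<close>

definition count_blocks :: "'a set list \<Rightarrow> 'a \<Rightarrow> nat" where
  "count_blocks M i = card {j. j < length M \<and> i \<in> M ! j}"

lemma prod_if_const_power:
  "finite A \<Longrightarrow> (\<Prod>j\<in>A. if P j then (\<sigma>::real) else 1) = \<sigma> ^ card {j\<in>A. P j}"
  by (simp add: prod.If_cases Collect_conj_eq Int_commute inf_left_commute)

lemma prod_single_scale:
  "(\<Prod>i\<in>K. ((\<lambda>_. 1)(i0 := \<sigma>)) i) = (if finite K \<and> i0 \<in> K then \<sigma> else (1::real))"
  by (cases "finite K") (auto simp: prod.If_cases Int_def)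

lemma prod_blocks_single_scale:
  assumes "\<And>j. j < length M \<Longrightarrow> finite (M ! j)"
  shows "(\<Prod>j<length M. \<Prod>i\<in>M ! j. ((\<lambda>_. 1)(i0 := \<sigma>)) i) = (\<sigma>::real) ^ count_blocks M i0"
proof -
  have "(\<Prod>j<length M. \<Prod>i\<in>M ! j. ((\<lambda>_. 1)(i0 := \<sigma>)) i) = (\<Prod>j<length M. if i0 \<in> M ! j then \<sigma> else 1)"
    using assms by (intro prod.cong) (auto simp: prod_single_scale)
  also have "\<dots> = \<sigma> ^ count_blocks M i0"
    unfolding count_blocks_def by (subst prod_if_const_power) (auto simp: lessThan_def)
  finally show ?thesis .
qed

lemma count_blocks_repeat:
  assumes "i \<in> K"
  shows "2 \<le> count_blocks (L @ [K, K]) i"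
proof -
  have "{length L, Suc (length L)} \<subseteq> {j. j < length (L @ [K, K]) \<and> i \<in> (L @ [K, K]) ! j}"
    using assms by (auto simp: nth_append)
  from card_mono[OF _ this] show ?thesis by (simp add: count_blocks_def)
qed

lemma partition_on_count_blocks:
  assumes count: "\<And>i. count_blocks M i = (if i \<in> J then 1 else 0)" and "{} \<notin> set M"
  shows "partition_on J (set M)"
proof -
  have "\<Union>(set M) = J"
  proof (intro equalityI subsetI)
    fix i assume "i \<in> \<Union>(set M)"
    then obtain j where "j < length M" "i \<in> M ! j" by (auto simp: in_set_conv_nth)
    then have "count_blocks M i \<noteq> 0" by (auto simp: count_blocks_def)
    then show "i \<in> J" using count[of i] by (auto split: if_splits)
  next
    fix i assume "i \<in> J"
    then have "card {j. j < length M \<and> i \<in> M ! j} = 1" using count[of i] by (simp add: count_blocks_def)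
    then obtain j where "j < length M" "i \<in> M ! j" by (metis (no_types, lifting) card_1_singletonE mem_Collect_eq singletonI)
    then show "i \<in> \<Union>(set M)" by auto
  qed
  moreover have "disjoint (set M)"
  proof (rule pairwiseI)
    fix p q assume pq: "p \<in> set M" "q \<in> set M" "p \<noteq> q"
    show "disjnt p q"
    proof (rule ccontr)
      assume "\<not> disjnt p q"
      then obtain i where i: "i \<in> p" "i \<in> q" by (auto simp: disjnt_def)
      obtain a b where ab: "a < length M" "b < length M" "M ! a = p" "M ! b = q"
        using pq by (auto simp: in_set_conv_nth)
      then have "a \<noteq> b" using pq by auto
      moreover have "{a, b} \<subseteq> {j. j < length M \<and> i \<in> M ! j}" using ab i by auto
      ultimately have "2 \<le> count_blocks M i"
        unfolding count_blocks_def by (metis card_2_iff card_mono finite_Collect_conjI finite_Collect_less_nat)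
      then show False using count[of i] by (auto split: if_splits)
    qed
  qed
  ultimately show ?thesis using assms(2) by (simp add: partition_on_def)
qed

section \<open>Scale-equivariant smooth maps\<close>

text \<open>The locale keeps only what naturality is used for: bar_scale n s is the image of the
  rescaling morphism grass_scale s under E-bar (lemma barmap_grass_scale).\<close>

locale scale_equivariant =
  fixes g :: "(nat set \<Rightarrow> 'e0::{real_vector,t2_space} \<times> 'e1::{real_vector,t2_space})
              \<Rightarrow> nat set \<Rightarrow> 'f0::{real_vector,t2_space} \<times> 'f1::{real_vector,t2_space}"
    and U :: "(nat set \<Rightarrow> 'e0 \<times> 'e1) set" and n :: nat and x :: "nat set \<Rightarrow> 'e0 \<times> 'e1"
  assumes lcs_E: "lcs TYPE('e0 \<times> 'e1)" and lcs_F: "lcs TYPE('f0 \<times> 'f1)"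
    and smooth: "bsmooth (sbar n) U g"
    and open_U: "openin (top_of_set (sbar n)) U"
    and bar_scale_U: "\<And>s y. y \<in> U \<Longrightarrow> bar_scale n s y \<in> U"
    and g_bar_scale: "\<And>s y. y \<in> U \<Longrightarrow> g (bar_scale n s y) = bar_scale n s (g y)"
    and x_in_U: "x \<in> U"
begin

definition blocks :: "nat set set" where
  "blocks = Pow {1..n} - {{}}"

text \<open>param t is the point x_t = x_0 + sum_K t_K x_K, and dg L t is the derivative
  d^l g(x_t)(x_L1, ..., x_Ll) for the list of blocks L = [L1, ..., Ll].\<close>

definition param :: "(nat set \<Rightarrow> real) \<Rightarrow> nat set \<Rightarrow> 'e0 \<times> 'e1" where
  "param t = (\<lambda>J. (if J = {} then 1 else t J) *\<^sub>R x J)"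

definition block_dirs :: "nat set list \<Rightarrow> nat \<Rightarrow> nat set \<Rightarrow> 'e0 \<times> 'e1" where
  "block_dirs L = (\<lambda>i. if i < length L then compI x (L ! i) else (\<lambda>_. 0))"

definition dg :: "nat set list \<Rightarrow> (nat set \<Rightarrow> real) \<Rightarrow> nat set \<Rightarrow> 'f0 \<times> 'f1" where
  "dg L t = bder g (length L) (block_dirs L) (param t)"

definition scale_params :: "(nat \<Rightarrow> real) \<Rightarrow> (nat set \<Rightarrow> real) \<Rightarrow> nat set \<Rightarrow> real" where
  "scale_params s t = (\<lambda>K. (\<Prod>i\<in>K. s i) * t K)"

lemma U_sbar: "U \<subseteq> sbar n"
  using smooth by (simp add: bsmooth_def)

lemma x_sbar: "x \<in> sbar n"
  using x_in_U U_sbar by blast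

lemma x_outside: "\<not> J \<subseteq> {1..n} \<Longrightarrow> x J = 0"
  using x_sbar by (simp add: sbar_def)

lemma finite_blocks: "finite blocks"
  by (simp add: blocks_def)

lemma finite_block: "K \<in> blocks \<Longrightarrow> finite K"
  by (auto simp: blocks_def intro: finite_subset)

lemma param_sbar: "param t \<in> sbar n"
  using x_sbar by (simp add: sbar_def param_def)

lemma compI_sbar: "compI x K \<in> sbar n"
  using x_sbar by (simp add: sbar_def compI_def)

lemma block_dirs_dirs: "set L \<subseteq> blocks \<Longrightarrow> block_dirs L \<in> dirs (sbar n) (length L)"
  by (auto simp: dirs_def block_dirs_def compI_sbar)

lemma param_cong:
  assumes "\<And>K. K \<in> blocks \<Longrightarrow> t K = t' K"
  shows "param t = param t'"
proof
  fix J
  show "param t J = param t' J"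
    using assms[of J] x_outside[of J] by (cases "J \<in> blocks") (auto simp: param_def blocks_def)
qed

lemma param_zero: "param (\<lambda>_. 0) = comp0 x"
  by (auto simp: param_def comp0_def)

lemma param_one: "param (\<lambda>_. 1) = x"
  by (simp add: param_def)

lemma param_add_compI: "K \<in> blocks \<Longrightarrow> vadd (param t) (vsc r (compI x K)) = param (t(K := t K + r))"
  by (auto simp: param_def vadd_def vsc_def compI_def blocks_def algebra_simps)

lemma bar_scale_param: "bar_scale n s (param t) = param (scale_params s t)"
  by (auto simp: bar_scale_def param_def scale_params_def x_outside)

lemma bar_scale_compI: "K \<in> blocks \<Longrightarrow> bar_scale n s (compI x K) = vsc (\<Prod>i\<in>K. s i) (compI x K)"
  by (auto simp: bar_scale_def compI_def vsc_def blocks_def)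

lemma segment_in_U:
  assumes "q \<in> U" "h \<in> sbar n"
  shows "\<exists>d>0. \<forall>r. \<bar>r\<bar> < d \<longrightarrow> vadd q (vsc r h) \<in> U"
proof -
  have "((\<lambda>r::real. vadd q (vsc r h)) \<longlongrightarrow> vadd q (vsc 0 h)) (nhds 0)"
    unfolding tendsto_fun_iff vadd_def vsc_def
    by (intro allI lcs_tendsto_add[OF lcs_E] lcs_tendsto_scaleR[OF lcs_E] tendsto_const filterlim_ident)
  moreover have "vadd q (vsc 0 h) = q" by (simp add: vadd_def vsc_def)
  ultimately have "eventually (\<lambda>r. vadd q (vsc r h) \<in> U) (nhds 0)"
    using assms U_sbar by (intro openin_eventually_in[OF open_U] always_eventually)
                          (auto intro!: sbar_add_scale)
  then show ?thesis by (auto simp: eventually_nhds_metric dist_real_def)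
qed

lemma param_zero_in_U: "param (\<lambda>_. 0) \<in> U"
proof -
  have "bar_scale n (\<lambda>_. 0) x = param (scale_params (\<lambda>_. 0) (\<lambda>_. 1))"
    by (metis bar_scale_param param_one)
  also have "\<dots> = param (\<lambda>_. 0)"
    by (rule param_cong) (auto simp: scale_params_def blocks_def dest: finite_subset)
  finally show ?thesis
    using bar_scale_U[OF x_in_U, of "\<lambda>_. 0"] by simp
qed

lemma box_in_U: "\<exists>\<delta>>0. \<delta> \<le> 1 \<and> (\<forall>t. (\<forall>K\<in>blocks. \<bar>t K\<bar> < \<delta>) \<longrightarrow> param t \<in> U)"
proof -
  obtain X where X: "\<And>c. open (X c)" "finite {c. X c \<noteq> UNIV}" "\<And>c. param (\<lambda>_. 0) c \<in> X c"
    "\<And>y. y \<in> sbar n \<Longrightarrow> (\<And>c. y c \<in> X c) \<Longrightarrow> y \<in> U"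
    using openin_fun_contains_box[OF open_U param_zero_in_U] by blast
  have "eventually (\<lambda>r. param (\<lambda>_. r) c \<in> X c) (nhds 0)" for c
  proof -
    have "((\<lambda>r::real. (if c = {} then 1 else r) *\<^sub>R x c) \<longlongrightarrow> (if c = {} then 1 else 0) *\<^sub>R x c) (nhds 0)"
      by (intro lcs_tendsto_scaleR[OF lcs_E] tendsto_const) (auto intro: filterlim_ident)
    then show ?thesis
      using X(1,3) unfolding param_def by (rule topological_tendstoD)
  qed
  then have "eventually (\<lambda>r. \<forall>c\<in>{c. X c \<noteq> UNIV}. param (\<lambda>_. r) c \<in> X c) (nhds 0)"
    using X(2) by (intro eventually_ball_finite) auto
  then obtain d where d: "d > 0" "\<And>r. \<bar>r\<bar> < d \<Longrightarrow> \<forall>c\<in>{c. X c \<noteq> UNIV}. param (\<lambda>_. r) c \<in> X c"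
    by (auto simp: eventually_nhds_metric dist_real_def)
  have "param t \<in> U" if t: "\<forall>K\<in>blocks. \<bar>t K\<bar> < min d 1" for t
  proof (rule X(4)[OF param_sbar])
    fix c
    show "param t c \<in> X c"
    proof (cases "X c = UNIV \<or> c \<notin> blocks")
      case True
      have "param t c = param (\<lambda>_. 0) c" if "c \<notin> blocks"
        using that x_outside[of c] by (auto simp: param_def blocks_def)
      then show ?thesis using True X(3)[of c] by auto
    next
      case False
      then have "param t c = param (\<lambda>_. t c) c" by (auto simp: param_def)
      then show ?thesis using d(2)[of "t c"] t False by auto
    qed
  qed
  with d(1) show ?thesis by (intro exI[of _ "min d 1"]) auto
qed

definition radius :: real where
  "radius = (SOME \<delta>. \<delta> > 0 \<and> \<delta> \<le> 1 \<and> (\<forall>t. (\<forall>K\<in>blocks. \<bar>t K\<bar> < \<delta>) \<longrightarrow> param t \<in> U))"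

definition in_box :: "(nat set \<Rightarrow> real) \<Rightarrow> bool" where
  "in_box t \<longleftrightarrow> (\<forall>K\<in>blocks. \<bar>t K\<bar> < radius)"

lemma radius: "radius > 0" "radius \<le> 1" and in_box_param: "in_box t \<Longrightarrow> param t \<in> U"
  using someI_ex[OF box_in_U] unfolding radius_def[symmetric] in_box_def by blast+

lemma in_box_zero: "in_box (\<lambda>_. 0)"
  using radius by (simp add: in_box_def)

lemma in_box_upd: "in_box t \<Longrightarrow> \<bar>u\<bar> < radius \<Longrightarrow> in_box (t(K := u))"
  by (simp add: in_box_def)

lemma bder_bar_scale:
  assumes "q \<in> U" "\<And>i. i < l \<Longrightarrow> h i \<in> sbar n"
  shows "bder g l (\<lambda>i. bar_scale n s (h i)) (bar_scale n s q) = bar_scale n s (bder g l h q)"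
  using assms
proof (induction l arbitrary: q)
  case 0
  then show ?case by (simp add: g_bar_scale)
next
  case (Suc l)
  let ?hs = "\<lambda>i. bar_scale n s (h i)"
  have IH: "\<And>q. q \<in> U \<Longrightarrow> bder g l ?hs (bar_scale n s q) = bar_scale n s (bder g l h q)"
    using Suc by auto
  obtain d where d: "d > 0" "\<And>r. \<bar>r\<bar> < d \<Longrightarrow> vadd q (vsc r (h l)) \<in> U"
    using segment_in_U[OF Suc.prems(1), of "h l"] Suc.prems(2) by auto
  have ev: "eventually (\<lambda>r. bar_scale n s (vsc (1 / r) (vsub (bder g l h (vadd q (vsc r (h l)))) (bder g l h q)))
          = vsc (1 / r) (vsub (bder g l ?hs (vadd (bar_scale n s q) (vsc r (?hs l))))
                              (bder g l ?hs (bar_scale n s q)))) (at 0)"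
    unfolding eventually_at
  proof (intro exI[of _ d] conjI ballI impI)
    fix r :: real assume "r \<noteq> 0 \<and> dist r 0 < d"
    then have qr: "vadd q (vsc r (h l)) \<in> U" using d by auto
    have eq: "vadd (bar_scale n s q) (vsc r (bar_scale n s (h l))) = bar_scale n s (vadd q (vsc r (h l)))"
      by (simp add: bar_scale_vadd bar_scale_vsc)
    show "bar_scale n s (vsc (1 / r) (vsub (bder g l h (vadd q (vsc r (h l)))) (bder g l h q)))
          = vsc (1 / r) (vsub (bder g l ?hs (vadd (bar_scale n s q) (vsc r (?hs l))))
                              (bder g l ?hs (bar_scale n s q)))"
      by (simp only: eq IH[OF qr] IH[OF Suc.prems(1)] bar_scale_vsc bar_scale_vsub)
  qed (use d in auto)
  have "((\<lambda>r. vsc (1 / r) (vsub (bder g l h (vadd q (vsc r (h l)))) (bder g l h q)))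
           \<longlongrightarrow> bder g (Suc l) h q) (at 0)"
    using Suc.prems by (intro bsmooth_tendsto_bder[OF smooth]) auto
  then have "((\<lambda>r. vsc (1 / r) (vsub (bder g l ?hs (vadd (bar_scale n s q) (vsc r (?hs l))))
                                     (bder g l ?hs (bar_scale n s q))))
               \<longlongrightarrow> bar_scale n s (bder g (Suc l) h q)) (at 0)"
    using tendsto_bar_scale[OF lcs_F, of _ _ _ n s] tendsto_cong[OF ev] by blast
  then show ?case by (rule bder_unique)
qed

lemma bder_scale_dirs:
  assumes "q \<in> U" "\<And>i. i < l \<Longrightarrow> h i \<in> sbar n" "\<And>i. i < l \<Longrightarrow> c i \<noteq> 0"
  shows "bder g l (\<lambda>i. vsc (c i) (h i)) q = vsc (\<Prod>i<l. c i) (bder g l h q)"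
  using assms
proof (induction l arbitrary: q)
  case 0
  then show ?case by (simp add: vsc_def)
next
  case (Suc l)
  let ?hc = "\<lambda>i. vsc (c i) (h i)" and ?P = "\<Prod>i<l. c i"
  have cl: "c l \<noteq> 0" using Suc by auto
  have IH: "\<And>q. q \<in> U \<Longrightarrow> bder g l ?hc q = vsc ?P (bder g l h q)"
    using Suc by auto
  define Q where "Q r = vsc (1 / r) (vsub (bder g l h (vadd q (vsc r (h l)))) (bder g l h q))" for r
  have "(Q \<longlongrightarrow> bder g (Suc l) h q) (at 0)"
    unfolding Q_def using Suc.prems by (intro bsmooth_tendsto_bder[OF smooth]) auto
  then have T: "((\<lambda>r. vsc (?P * c l) (Q (r * c l))) \<longlongrightarrow> vsc (?P * c l) (bder g (Suc l) h q)) (at 0)"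
    by (intro tendsto_vsc[OF lcs_F] filterlim_compose[OF _ filterlim_mult_const_at_0[OF cl]])
  obtain d where d: "d > 0" "\<And>r. \<bar>r\<bar> < d \<Longrightarrow> vadd q (vsc r (h l)) \<in> U"
    using segment_in_U[OF Suc.prems(1), of "h l"] Suc.prems(2) by auto
  have ev: "eventually (\<lambda>r. vsc (?P * c l) (Q (r * c l))
              = vsc (1 / r) (vsub (bder g l ?hc (vadd q (vsc r (?hc l)))) (bder g l ?hc q))) (at 0)"
    unfolding eventually_at
  proof (intro exI[of _ "d / \<bar>c l\<bar>"] conjI ballI impI)
    fix r :: real assume r: "r \<noteq> 0 \<and> dist r 0 < d / \<bar>c l\<bar>"
    then have "\<bar>r * c l\<bar> < d" using cl by (auto simp: field_simps abs_mult)
    then have qr: "vadd q (vsc (r * c l) (h l)) \<in> U" using d by auto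
    have eq: "vsc r (vsc (c l) (h l)) = vsc (r * c l) (h l)" by (simp add: vsc_def)
    show "vsc (?P * c l) (Q (r * c l))
            = vsc (1 / r) (vsub (bder g l ?hc (vadd q (vsc r (?hc l)))) (bder g l ?hc q))"
      unfolding eq IH[OF qr] IH[OF Suc.prems(1)] Q_def using r cl
      by (auto simp: vsc_def vsub_def fun_eq_iff scaleR_diff_right field_simps)
  qed (use d cl in auto)
  have "((\<lambda>r. vsc (1 / r) (vsub (bder g l ?hc (vadd q (vsc r (?hc l)))) (bder g l ?hc q)))
           \<longlongrightarrow> vsc (\<Prod>i<Suc l. c i) (bder g (Suc l) h q)) (at 0)"
    using tendsto_cong[OF ev] T by (simp add: mult.commute)
  then show ?case by (rule bder_unique)
qed

lemma dg_homogeneous: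
  assumes s: "\<And>i. s i \<noteq> 0" and "param t \<in> U" and M: "set M \<subseteq> blocks"
  shows "vsc (\<Prod>j<length M. \<Prod>i\<in>M ! j. s i) (dg M (scale_params s t)) = bar_scale n s (dg M t)"
proof -
  define c where "c j = (if j < length M then (\<Prod>i\<in>M ! j. s i) else 1)" for j
  have c: "c j \<noteq> 0" for j
  proof (cases "j < length M")
    case True
    then have "finite (M ! j)" using M nth_mem[of j M] finite_block by blast
    then show ?thesis using s by (simp add: c_def prod_zero_iff)
  qed (simp add: c_def)
  have dirs: "\<And>i. i < length M \<Longrightarrow> block_dirs M i \<in> sbar n"
    by (simp add: block_dirs_def compI_sbar)
  have dirs_scale: "(\<lambda>i. bar_scale n s (block_dirs M i)) = (\<lambda>i. vsc (c i) (block_dirs M i))"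
  proof
    fix i
    show "bar_scale n s (block_dirs M i) = vsc (c i) (block_dirs M i)"
    proof (cases "i < length M")
      case True
      then have "M ! i \<in> blocks" using M by auto
      with True show ?thesis by (simp add: block_dirs_def c_def bar_scale_compI)
    qed (auto simp: block_dirs_def c_def bar_scale_def vsc_def)
  qed
  have "bar_scale n s (dg M t) = bder g (length M) (\<lambda>i. bar_scale n s (block_dirs M i)) (bar_scale n s (param t))"
    unfolding dg_def by (rule bder_bar_scale[symmetric]) (use assms(2) dirs in auto)
  also have "\<dots> = bder g (length M) (\<lambda>i. vsc (c i) (block_dirs M i)) (param (scale_params s t))"
    unfolding dirs_scale bar_scale_param ..
  also have "\<dots> = vsc (\<Prod>i<length M. c i) (dg M (scale_params s t))"
    unfolding dg_def using bar_scale_U[OF assms(2), of s] c dirs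
    by (intro bder_scale_dirs) (auto simp: bar_scale_param)
  finally show ?thesis by (simp add: c_def)
qed

lemma in_box_single_scale:
  assumes "in_box t" "0 \<le> \<sigma>" "\<sigma> \<le> 1"
  shows "in_box (scale_params ((\<lambda>_. 1)(i0 := \<sigma>)) t)"
  unfolding in_box_def scale_params_def prod_single_scale
proof
  fix K assume "K \<in> blocks"
  then have "\<bar>t K\<bar> < radius" using assms(1) by (simp add: in_box_def)
  moreover have "\<bar>(if finite K \<and> i0 \<in> K then \<sigma> else 1) * t K\<bar> \<le> \<bar>t K\<bar>"
    using assms(2,3) by (auto simp: abs_mult intro: mult_left_le_one_le)
  ultimately show "\<bar>(if finite K \<and> i0 \<in> K then \<sigma> else 1) * t K\<bar> < radius" by linarith
qed

lemma tendsto_dg_single_scale: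
  assumes t: "in_box t" and M: "set M \<subseteq> blocks"
  shows "((\<lambda>\<sigma>. dg M (scale_params ((\<lambda>_. 1)(i0 := \<sigma>)) t))
           \<longlongrightarrow> dg M (scale_params ((\<lambda>_. 1)(i0 := 0)) t)) (at_right 0)"
proof -
  let ?p = "\<lambda>\<sigma>. param (scale_params ((\<lambda>_. 1)(i0 := \<sigma>)) t)"
  let ?D = "U \<times> dirs (sbar n) (length M)"
  have lim: "(?p \<longlongrightarrow> ?p 0) (at_right 0)"
    unfolding tendsto_fun_iff param_def scale_params_def prod_single_scale
    by (intro allI lcs_tendsto_scaleR[OF lcs_E] tendsto_const)
       (auto intro!: tendsto_eq_intros tendsto_ident_at)
  have mem: "(?p \<sigma>, block_dirs M) \<in> ?D" if "0 \<le> \<sigma>" "\<sigma> \<le> 1" for \<sigma>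
    using in_box_param[OF in_box_single_scale[OF t that]] block_dirs_dirs[OF M] by blast
  have "eventually (\<lambda>\<sigma>. \<sigma> \<in> {0<..<1}) (at_right (0::real))"
    by (rule eventually_at_right_real) simp
  then have ev: "eventually (\<lambda>\<sigma>. (?p \<sigma>, block_dirs M) \<in> ?D) (at_right 0)"
    by (rule eventually_mono) (rule mem; simp)
  have "continuous_on ?D (\<lambda>p. bder g (length M) (snd p) (fst p))"
    using smooth by (simp add: bsmooth_def)
  from continuous_on_tendsto_compose[OF this tendsto_Pair[OF lim tendsto_const] mem ev]
  show ?thesis by (simp add: dg_def)
qed

lemma dg_outside:
  assumes "in_box t" "set M \<subseteq> blocks" "\<not> J \<subseteq> {1..n}"
  shows "dg M t J = 0"
proof -
  have hom: "vsc (\<Prod>j<length M. \<Prod>i\<in>M ! j. 1) (dg M (scale_params (\<lambda>_. 1) t))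
               = bar_scale n (\<lambda>_. 1) (dg M t)"
    by (rule dg_homogeneous[OF _ in_box_param[OF assms(1)] assms(2)]) simp
  have "dg M t J = vsc (\<Prod>j<length M. \<Prod>i\<in>M ! j. 1) (dg M (scale_params (\<lambda>_. 1) t)) J"
    by (simp add: scale_params_def vsc_def)
  also have "\<dots> = bar_scale n (\<lambda>_. 1) (dg M t) J"
    by (simp only: hom)
  finally show ?thesis using assms(3) by (simp add: bar_scale_def)
qed

lemma dg_single_scale:
  assumes t: "in_box t" and M: "set M \<subseteq> blocks" and J: "J \<subseteq> {1..n}" and "\<sigma> \<noteq> 0"
  shows "\<sigma> ^ count_blocks M i0 *\<^sub>R dg M (scale_params ((\<lambda>_. 1)(i0 := \<sigma>)) t) J
           = \<sigma> ^ (if i0 \<in> J then 1 else 0) *\<^sub>R dg M t J"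
proof -
  let ?s = "(\<lambda>_. 1)(i0 := \<sigma>)"
  have fin: "\<And>j. j < length M \<Longrightarrow> finite (M ! j)" using M nth_mem finite_block by blast
  have "vsc (\<Prod>j<length M. \<Prod>i\<in>M ! j. ?s i) (dg M (scale_params ?s t)) = bar_scale n ?s (dg M t)"
    by (rule dg_homogeneous[OF _ in_box_param[OF t] M]) (use assms(4) in auto)
  then have "vsc (\<sigma> ^ count_blocks M i0) (dg M (scale_params ?s t)) J = bar_scale n ?s (dg M t) J"
    by (simp only: prod_blocks_single_scale[OF fin])
  then have "\<sigma> ^ count_blocks M i0 *\<^sub>R dg M (scale_params ?s t) J = (\<Prod>i\<in>J. ?s i) *\<^sub>R dg M t J"
    using J by (simp only: vsc_def bar_scale_def if_True)
  also have "(\<Prod>i\<in>J. ?s i) = \<sigma> ^ (if i0 \<in> J then 1 else 0)"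
    using finite_subset[OF J] by (simp add: prod_single_scale)
  finally show ?thesis .
qed

lemma dg_repeated_index:
  assumes t: "in_box t" and M: "set M \<subseteq> blocks" and "2 \<le> count_blocks M i0"
  shows "dg M t J = 0"
proof (cases "J \<subseteq> {1..n}")
  case False
  then show ?thesis using dg_outside t M by blast
next
  case J: True
  define m where "m = count_blocks M i0"
  define b where "b = (if i0 \<in> J then 1 else 0::nat)"
  have mb: "b \<le> m" "1 \<le> m - b" using assms(3) by (auto simp: m_def b_def)
  \<comment> \<open>The right-hand side tends to 0 as \<sigma> \<rightarrow> 0.\<close>
  have eq: "dg M t J = \<sigma> ^ (m - b) *\<^sub>R dg M (scale_params ((\<lambda>_. 1)(i0 := \<sigma>)) t) J" if "0 < \<sigma>" for \<sigma>
  proof -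
    have "\<sigma> ^ m = \<sigma> ^ b * \<sigma> ^ (m - b)" using mb by (simp flip: power_add)
    then have "\<sigma> ^ b *\<^sub>R (\<sigma> ^ (m - b) *\<^sub>R dg M (scale_params ((\<lambda>_. 1)(i0 := \<sigma>)) t) J) = \<sigma> ^ b *\<^sub>R dg M t J"
      using dg_single_scale[OF t M J, of \<sigma> i0] that by (simp only: scaleR_scaleR m_def b_def)
    then show ?thesis using that by (simp only: scaleR_cancel_left) simp
  qed
  have "((\<lambda>\<sigma>. \<sigma> ^ (m - b) *\<^sub>R dg M (scale_params ((\<lambda>_. 1)(i0 := \<sigma>)) t) J)
           \<longlongrightarrow> 0 ^ (m - b) *\<^sub>R dg M (scale_params ((\<lambda>_. 1)(i0 := 0)) t) J) (at_right 0)"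
  proof (rule lcs_tendsto_scaleR[OF lcs_F])
    show "((\<lambda>\<sigma>::real. \<sigma> ^ (m - b)) \<longlongrightarrow> 0 ^ (m - b)) (at_right 0)"
      by (intro tendsto_intros)
    show "((\<lambda>\<sigma>. dg M (scale_params ((\<lambda>_. 1)(i0 := \<sigma>)) t) J)
            \<longlongrightarrow> dg M (scale_params ((\<lambda>_. 1)(i0 := 0)) t) J) (at_right 0)"
      using tendsto_dg_single_scale[OF t M, of i0] by (simp only: tendsto_fun_iff)
  qed
  moreover have "eventually (\<lambda>\<sigma>. dg M t J = \<sigma> ^ (m - b) *\<^sub>R dg M (scale_params ((\<lambda>_. 1)(i0 := \<sigma>)) t) J)
                   (at_right (0::real))"
    using eventually_at_right_less[of "0::real"] by (rule eventually_mono) (rule eq)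
  ultimately have "((\<lambda>_. dg M t J) \<longlongrightarrow> 0 ^ (m - b) *\<^sub>R dg M (scale_params ((\<lambda>_. 1)(i0 := 0)) t) J) (at_right (0::real))"
    by (simp only: tendsto_cong)
  then have "dg M t J = 0 ^ (m - b) *\<^sub>R dg M (scale_params ((\<lambda>_. 1)(i0 := 0)) t) J"
    using tendsto_unique[OF trivial_limit_at_right_real tendsto_const] by blast
  moreover have "(0::real) ^ (m - b) = 0" using mb by simp
  ultimately show ?thesis by simp
qed

lemma dg_difference_quotient:
  assumes "in_box t" "K \<in> blocks" "set L \<subseteq> blocks"
  shows "((\<lambda>r. vsc (1 / r) (vsub (dg L (t(K := t K + r))) (dg L t))) \<longlongrightarrow> dg (L @ [K]) t) (at 0)"
proof -
  have "((\<lambda>r. vsc (1 / r) (vsub (bder g (length L) (block_dirs (L @ [K]))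
                                     (vadd (param t) (vsc r (block_dirs (L @ [K]) (length L)))))
                                 (bder g (length L) (block_dirs (L @ [K])) (param t))))
          \<longlongrightarrow> bder g (Suc (length L)) (block_dirs (L @ [K])) (param t)) (at 0)"
    by (rule bsmooth_tendsto_bder[OF smooth in_box_param[OF assms(1)]])
       (auto simp: block_dirs_def compI_sbar)
  moreover have "bder g (length L) (block_dirs (L @ [K])) = bder g (length L) (block_dirs L)"
    by (auto intro!: bder_cong simp: block_dirs_def nth_append)
  moreover have "block_dirs (L @ [K]) (length L) = compI x K"
    by (simp add: block_dirs_def)
  ultimately show ?thesis
    by (simp add: dg_def param_add_compI[OF assms(2)])
qed

lemma dg_difference_quotient_at:
  assumes "in_box t" "K \<in> blocks" "set L \<subseteq> blocks"
  shows "((\<lambda>r. (1 / r) *\<^sub>R (dg L (t(K := t K + r)) J - dg L t J)) \<longlongrightarrow> dg (L @ [K]) t J) (at 0)"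
  using dg_difference_quotient[OF assms] by (simp add: tendsto_fun_iff vsc_def vsub_def)

lemma dg_affine:
  assumes t: "in_box t" and K: "K \<in> blocks" and L: "set L \<subseteq> blocks" and u: "\<bar>u\<bar> < radius"
  shows "dg L (t(K := u)) J = dg L t J + (u - t K) *\<^sub>R dg (L @ [K]) t J"
proof -
  have "\<bar>t K\<bar> < radius" using t K by (simp add: in_box_def)
  define \<phi> where "\<phi> v = dg L (t(K := v)) J" for v
  define \<psi> where "\<psi> v = dg (L @ [K]) (t(K := v)) J" for v
  obtain i where "i \<in> K" using K by (auto simp: blocks_def)
  have \<psi>_const: "\<psi> v = \<psi> (t K)" if "\<bar>v\<bar> < radius" for v
  proof -
    have "((\<lambda>h. (1 / h) *\<^sub>R (\<psi> (w + h) - \<psi> w)) \<longlongrightarrow> 0) (at 0)" if "\<bar>w\<bar> < radius" for w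
    proof -
      have "dg (L @ [K, K]) (t(K := w)) J = 0"
        using dg_repeated_index[OF in_box_upd[OF t that, of K] _ count_blocks_repeat[OF \<open>i \<in> K\<close>]] K L by simp
      then show ?thesis
        using dg_difference_quotient_at[OF in_box_upd[OF t that, of K] K, of "L @ [K]" J] K L by (simp add: \<psi>_def)
    qed
    then have "\<psi> (max v (t K)) = \<psi> (min v (t K)) + (max v (t K) - min v (t K)) *\<^sub>R 0"
      using that \<open>\<bar>t K\<bar> < radius\<close>
      by (intro lcs_derivative_const_imp_affine[OF lcs_F]) auto
    then show ?thesis by (cases "v \<le> t K") (auto simp: max_def min_def)
  qed
  have "((\<lambda>h. (1 / h) *\<^sub>R (\<phi> (w + h) - \<phi> w)) \<longlongrightarrow> dg (L @ [K]) t J) (at 0)" if "\<bar>w\<bar> < radius" for w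
    using dg_difference_quotient_at[OF in_box_upd[OF t that, of K] K L, of J] \<psi>_const[OF that]
    by (simp add: \<phi>_def \<psi>_def)
  then have "\<phi> (max u (t K)) = \<phi> (min u (t K)) + (max u (t K) - min u (t K)) *\<^sub>R dg (L @ [K]) t J"
    using u \<open>\<bar>t K\<bar> < radius\<close> by (intro lcs_derivative_const_imp_affine[OF lcs_F]) auto
  then show ?thesis
    by (cases "u \<le> t K") (auto simp: \<phi>_def max_def min_def algebra_simps)
qed

lemma dg_swap_last:
  assumes t: "in_box t" and K: "K \<in> blocks" and K': "K' \<in> blocks" and L: "set L \<subseteq> blocks"
  shows "dg (L @ [K, K']) t J = dg (L @ [K', K]) t J"
proof (cases "K = K'")
  case False
  have tK: "\<bar>t K\<bar> < radius" "\<bar>t K'\<bar> < radius" using t K K' by (auto simp: in_box_def)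
  define d where "d = (radius - max \<bar>t K\<bar> \<bar>t K'\<bar>) / 2"
  have "max \<bar>t K\<bar> \<bar>t K'\<bar> < radius" using tK by simp
  then have "d > 0" "2 * d = radius - max \<bar>t K\<bar> \<bar>t K'\<bar>" by (simp_all add: d_def)
  then have d: "d > 0" "\<bar>t K + d\<bar> < radius" "\<bar>t K' + d\<bar> < radius"
    using abs_triangle_ineq[of "t K" d] abs_triangle_ineq[of "t K'" d]
      max.cobounded1[of "\<bar>t K\<bar>" "\<bar>t K'\<bar>"] max.cobounded2[of "\<bar>t K'\<bar>" "\<bar>t K\<bar>"] tK
    by linarith+
  define t1 where "t1 = t(K' := t K' + d)"
  define t2 where "t2 = t(K := t K + d)"
  have t12: "in_box t1" "in_box t2" using in_box_upd[OF t] d by (auto simp: t1_def t2_def)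
  \<comment> \<open>Reach the corner t1(K := t K + d) = t2(K' := t K' + d) along both paths and expand each
      with dg_affine; the second-order terms are d^2 times the two mixed derivatives.\<close>
  have corner: "t1(K := t K + d) = t2(K' := t K' + d)" using False by (auto simp: t1_def t2_def)
  have LK: "set (L @ [K]) \<subseteq> blocks" "set (L @ [K']) \<subseteq> blocks" using L K K' by auto
  have "dg L (t1(K := t K + d)) J = dg L t J + d *\<^sub>R dg (L @ [K']) t J
          + d *\<^sub>R (dg (L @ [K]) t J + d *\<^sub>R dg (L @ [K, K']) t J)"
    using dg_affine[OF t12(1) K L d(2), of J] dg_affine[OF t K' L d(3), of J]
      dg_affine[OF t K' LK(1) d(3), of J] False by (simp add: t1_def)
  moreover have "dg L (t2(K' := t K' + d)) J = dg L t J + d *\<^sub>R dg (L @ [K]) t J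
          + d *\<^sub>R (dg (L @ [K']) t J + d *\<^sub>R dg (L @ [K', K]) t J)"
    using dg_affine[OF t12(2) K' L d(3), of J] dg_affine[OF t K L d(2), of J]
      dg_affine[OF t K LK(2) d(2), of J] False by (simp add: t2_def)
  ultimately have "(d * d) *\<^sub>R dg (L @ [K, K']) t J = (d * d) *\<^sub>R dg (L @ [K', K]) t J"
    unfolding corner by (simp add: algebra_simps)
  with d(1) show ?thesis by simp
qed simp

lemma dg_append_cong:
  assumes "\<And>t. in_box t \<Longrightarrow> dg L1 t = dg L2 t" "set L1 \<subseteq> blocks" "set L2 \<subseteq> blocks"
    and "set M \<subseteq> blocks" "in_box t"
  shows "dg (L1 @ M) t = dg (L2 @ M) t"
  using assms(4,5)
proof (induction M arbitrary: t rule: rev_induct)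
  case Nil
  then show ?case using assms(1) by simp
next
  case (snoc K M)
  have K: "K \<in> blocks" and M: "set M \<subseteq> blocks" using snoc.prems by auto
  have tK: "\<bar>t K\<bar> < radius" using snoc.prems K by (auto simp: in_box_def)
  have ev: "eventually (\<lambda>r. vsc (1 / r) (vsub (dg (L1 @ M) (t(K := t K + r))) (dg (L1 @ M) t)) =
                            vsc (1 / r) (vsub (dg (L2 @ M) (t(K := t K + r))) (dg (L2 @ M) t))) (at 0)"
    unfolding eventually_at
  proof (intro exI[of _ "radius - \<bar>t K\<bar>"] conjI ballI impI)
    fix r :: real assume "r \<noteq> 0 \<and> dist r 0 < radius - \<bar>t K\<bar>"
    then have "in_box (t(K := t K + r))" by (intro in_box_upd[OF snoc.prems(2)]) auto
    then have "dg (L1 @ M) (t(K := t K + r)) = dg (L2 @ M) (t(K := t K + r))" by (rule snoc.IH[OF M])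
    then show "vsc (1 / r) (vsub (dg (L1 @ M) (t(K := t K + r))) (dg (L1 @ M) t)) =
               vsc (1 / r) (vsub (dg (L2 @ M) (t(K := t K + r))) (dg (L2 @ M) t))"
      by (simp only: snoc.IH[OF M snoc.prems(2)])
  qed (use tK in auto)
  have "set (L1 @ M) \<subseteq> blocks" "set (L2 @ M) \<subseteq> blocks" using assms(2,3) M by auto
  from this(1) have "((\<lambda>r. vsc (1 / r) (vsub (dg (L2 @ M) (t(K := t K + r))) (dg (L2 @ M) t)))
                       \<longlongrightarrow> dg ((L1 @ M) @ [K]) t) (at 0)"
    using tendsto_cong[OF ev] dg_difference_quotient[OF snoc.prems(2) K] by blast
  from tendsto_fun_unique[OF at_neq_bot this dg_difference_quotient[OF snoc.prems(2) K \<open>set (L2 @ M) \<subseteq> blocks\<close>]]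
  show ?case by simp
qed

lemma dg_move_to_end:
  assumes t: "in_box t"
  shows "set (A @ [K] @ C) \<subseteq> blocks \<Longrightarrow> dg (A @ [K] @ C) t = dg (A @ C @ [K]) t"
proof (induction C arbitrary: A)
  case (Cons c C)
  have swap: "dg ((A @ [K, c]) @ C) t = dg ((A @ [c, K]) @ C) t"
    using Cons.prems by (intro dg_append_cong[OF ext] dg_swap_last t) auto
  have "dg (A @ [K] @ c # C) t = dg ((A @ [c]) @ [K] @ C) t" using swap by simp
  also have "\<dots> = dg ((A @ [c]) @ C @ [K]) t" by (rule Cons.IH) (use Cons.prems in auto)
  finally show ?case by simp
qed simp

lemma dg_perm:
  assumes "mset L1 = mset L2" "set L1 \<subseteq> blocks" "in_box t"
  shows "dg L1 t = dg L2 t"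
  using assms
proof (induction L2 arbitrary: L1 t rule: rev_induct)
  case (snoc K L2)
  then obtain A C where L1: "L1 = A @ K # C"
    by (metis mset_eq_setD in_set_conv_decomp set_append Un_iff list.set_intros(1))
  then have "dg L1 t = dg ((A @ C) @ [K]) t"
    using dg_move_to_end[OF snoc.prems(3), of A K C] snoc.prems(2) by simp
  also have "\<dots> = dg (L2 @ [K]) t"
  proof (rule dg_append_cong)
    have m: "mset (A @ C) = mset L2" using snoc.prems(1) L1 by (simp add: add.commute)
    show AC: "set (A @ C) \<subseteq> blocks" using snoc.prems(2) L1 by auto
    show "\<And>t. in_box t \<Longrightarrow> dg (A @ C) t = dg L2 t" using snoc.IH[OF m AC] .
    show "set L2 \<subseteq> blocks" using AC mset_eq_setD[OF m] by blast
  qed (use snoc.prems L1 in auto)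
  finally show ?case .
qed simp

lemma dg_expansion:
  "distinct Ks \<Longrightarrow> set Ks \<subseteq> blocks \<Longrightarrow> set L \<subseteq> blocks \<Longrightarrow> in_box t \<Longrightarrow>
    (\<And>K. K \<in> blocks - set Ks \<Longrightarrow> t K = 0) \<Longrightarrow>
    dg L t J = (\<Sum>S\<in>Pow (set Ks). (\<Prod>K\<in>S. t K) *\<^sub>R dg (L @ filter (\<lambda>K. K \<in> S) Ks) (\<lambda>_. 0) J)"
proof (induction Ks arbitrary: L t)
  case Nil
  have "param t = param (\<lambda>_. 0)" by (rule param_cong) (use Nil in auto)
  then show ?case by (simp add: dg_def)
next
  case (Cons K Ks)
  have K: "K \<in> blocks" "K \<notin> set Ks" and Ks: "distinct Ks" "set Ks \<subseteq> blocks" using Cons.prems by auto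
  define t0 where "t0 = t(K := 0)"
  have t0: "in_box t0" unfolding t0_def by (rule in_box_upd[OF Cons.prems(4)]) (use radius in auto)
  have "\<bar>t K\<bar> < radius" using Cons.prems(4) K by (auto simp: in_box_def)
  then have aff: "dg L t J = dg L t0 J + t K *\<^sub>R dg (L @ [K]) t0 J"
    using dg_affine[OF t0 K(1) Cons.prems(3), of "t K" J] by (simp add: t0_def)
  have z0: "\<And>K'. K' \<in> blocks - set Ks \<Longrightarrow> t0 K' = 0" using Cons.prems(5) by (auto simp: t0_def)
  note IH = Cons.IH[OF Ks _ t0 z0]
  define F where "F S = (\<Prod>K\<in>S. t K) *\<^sub>R dg (L @ filter (\<lambda>K. K \<in> S) (K # Ks)) (\<lambda>_. 0) J" for S
  have F: "F S = (\<Prod>K\<in>S. t0 K) *\<^sub>R dg (L @ filter (\<lambda>K. K \<in> S) Ks) (\<lambda>_. 0) J"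
    "F (insert K S) = (t K * (\<Prod>K\<in>S. t0 K)) *\<^sub>R dg ((L @ [K]) @ filter (\<lambda>K. K \<in> S) Ks) (\<lambda>_. 0) J"
    if S: "S \<in> Pow (set Ks)" for S
  proof -
    have S': "K \<notin> S" "finite S" using S K finite_subset by auto
    then have "(\<Prod>K\<in>S. t K) = (\<Prod>K\<in>S. t0 K)" by (intro prod.cong) (auto simp: t0_def)
    moreover have "filter (\<lambda>K'. K' \<in> insert K S) Ks = filter (\<lambda>K. K \<in> S) Ks"
      using K(2) by (intro filter_cong) auto
    ultimately show "F S = (\<Prod>K\<in>S. t0 K) *\<^sub>R dg (L @ filter (\<lambda>K. K \<in> S) Ks) (\<lambda>_. 0) J"
      "F (insert K S) = (t K * (\<Prod>K\<in>S. t0 K)) *\<^sub>R dg ((L @ [K]) @ filter (\<lambda>K. K \<in> S) Ks) (\<lambda>_. 0) J"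
      using S' by (simp_all add: F_def)
  qed
  have "(\<Sum>S\<in>Pow (set (K # Ks)). F S) = (\<Sum>S\<in>Pow (set Ks). F S) + (\<Sum>S\<in>insert K ` Pow (set Ks). F S)"
    by (simp add: Pow_insert, rule sum.union_disjoint) (use K in auto)
  also have "\<dots> = (\<Sum>S\<in>Pow (set Ks). F S) + (\<Sum>S\<in>Pow (set Ks). F (insert K S))"
    by (subst sum.reindex) (use K in \<open>auto simp: inj_on_def\<close>)
  also have "\<dots> = (\<Sum>S\<in>Pow (set Ks). (\<Prod>K\<in>S. t0 K) *\<^sub>R dg (L @ filter (\<lambda>K. K \<in> S) Ks) (\<lambda>_. 0) J)
      + t K *\<^sub>R (\<Sum>S\<in>Pow (set Ks). (\<Prod>K\<in>S. t0 K) *\<^sub>R dg ((L @ [K]) @ filter (\<lambda>K. K \<in> S) Ks) (\<lambda>_. 0) J)"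
    by (simp only: sum.cong[OF refl F(1)] sum.cong[OF refl F(2)] scaleR_sum_right scaleR_scaleR)
  also have "\<dots> = dg L t J"
    using aff IH[OF Cons.prems(3)] IH[of "L @ [K]"] Cons.prems(3) K by simp
  finally show ?case by (simp add: F_def)
qed

lemma count_blocks_nonzero_dg:
  assumes M: "set M \<subseteq> blocks" and J: "J \<subseteq> {1..n}" and nz: "dg M (\<lambda>_. 0) J \<noteq> 0"
  shows "count_blocks M i = (if i \<in> J then 1 else 0)"
proof -
  have "scale_params ((\<lambda>_. 1)(i := 2)) (\<lambda>_. 0) = (\<lambda>_. 0)" by (simp add: scale_params_def)
  then have "(2::real) ^ count_blocks M i *\<^sub>R dg M (\<lambda>_. 0) J = 2 ^ (if i \<in> J then 1 else 0) *\<^sub>R dg M (\<lambda>_. 0) J"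
    using dg_single_scale[OF in_box_zero M J, of 2 i] by simp
  then have "(2::real) ^ count_blocks M i = 2 ^ (if i \<in> J then 1 else 0)"
    using nz by simp
  then show ?thesis by (simp only: power_inject_exp[of "2::real"])
qed

lemma dg_zero_unless_partition:
  assumes M: "set M \<subseteq> blocks" and "\<not> (J \<subseteq> {1..n} \<and> partition_on J (set M))"
  shows "dg M (\<lambda>_. 0) J = 0"
proof (rule ccontr)
  assume nz: "dg M (\<lambda>_. 0) J \<noteq> 0"
  then have J: "J \<subseteq> {1..n}" using dg_outside[OF in_box_zero M] by blast
  have "{} \<notin> set M" using M by (auto simp: blocks_def)
  with count_blocks_nonzero_dg[OF M J nz] have "partition_on J (set M)"
    by (rule partition_on_count_blocks)
  with J assms(2) show False by blast
qed

lemma partition_blocks: "partition_on I \<omega> \<Longrightarrow> I \<subseteq> {1..n} \<Longrightarrow> \<omega> \<subseteq> blocks"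
  by (auto simp: partition_on_def blocks_def)

lemma bder_blockdirs:
  assumes Ks: "distinct Ks" "set Ks = blocks" and \<omega>: "\<omega> \<subseteq> blocks"
  shows "bder g (card \<omega>) (blockdirs x \<omega>) (comp0 x) = dg (filter (\<lambda>K. K \<in> \<omega>) Ks) (\<lambda>_. 0)"
proof -
  define bs where "bs = (SOME bs. distinct bs \<and> set bs = \<omega>)"
  have "finite \<omega>" using \<omega> finite_blocks finite_subset by blast
  then have bs: "distinct bs" "set bs = \<omega>"
    unfolding bs_def using someI_ex[of "\<lambda>bs. distinct bs \<and> set bs = \<omega>"] finite_distinct_list by blast+
  have "blockdirs x \<omega> = block_dirs bs"
    unfolding blockdirs_def bs_def[symmetric] Let_def block_dirs_def ..
  moreover have "card \<omega> = length bs" using bs distinct_card by blast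
  ultimately have "bder g (card \<omega>) (blockdirs x \<omega>) (comp0 x) = dg bs (\<lambda>_. 0)"
    by (simp only: dg_def param_zero)
  also have "\<dots> = dg (filter (\<lambda>K. K \<in> \<omega>) Ks) (\<lambda>_. 0)"
  proof (rule dg_perm)
    have "set (filter (\<lambda>K. K \<in> \<omega>) Ks) = \<omega>" "distinct (filter (\<lambda>K. K \<in> \<omega>) Ks)" using Ks \<omega> by auto
    with bs show "mset bs = mset (filter (\<lambda>K. K \<in> \<omega>) Ks)" by (metis set_eq_iff_mset_eq_distinct)
    show "set bs \<subseteq> blocks" using bs \<omega> by simp
  qed (rule in_box_zero)
  finally show ?thesis .
qed

lemma g_partition_sum:
  assumes Ks: "distinct Ks" "set Ks = blocks" and J: "J \<subseteq> {1..n}"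
  shows "g x J = (\<Sum>\<omega> | partition_on J \<omega>. dg (filter (\<lambda>K. K \<in> \<omega>) Ks) (\<lambda>_. 0) J)"
proof -
  define \<epsilon> where "\<epsilon> = radius / 2"
  have \<epsilon>: "0 < \<epsilon>" "\<epsilon> < radius" "\<epsilon> < 1" using radius by (auto simp: \<epsilon>_def)
  \<comment> \<open>The parameters te are x rescaled by \<epsilon>, small enough to lie in the box.\<close>
  define te where "te K = \<epsilon> ^ card K" for K :: "nat set"
  have te: "in_box te" unfolding in_box_def
  proof
    fix K assume "K \<in> blocks"
    then have "1 \<le> card K" using finite_block by (auto simp: blocks_def Suc_le_eq card_gt_0_iff)
    then have "\<epsilon> ^ card K \<le> \<epsilon> ^ 1" using \<epsilon> by (intro power_decreasing) auto
    then show "\<bar>te K\<bar> < radius" using \<epsilon> by (simp add: te_def)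
  qed
  have "bar_scale n (\<lambda>_. \<epsilon>) x = param (scale_params (\<lambda>_. \<epsilon>) (\<lambda>_. 1))"
    by (metis bar_scale_param param_one)
  also have "\<dots> = param te" by (rule param_cong) (simp add: scale_params_def te_def)
  finally have "dg [] te J = \<epsilon> ^ card J *\<^sub>R g x J"
    using g_bar_scale[OF x_in_U, of "\<lambda>_. \<epsilon>"] J by (simp add: dg_def bar_scale_def)
  also have "dg [] te J = (\<Sum>S\<in>Pow blocks. (\<Prod>K\<in>S. te K) *\<^sub>R dg (filter (\<lambda>K. K \<in> S) Ks) (\<lambda>_. 0) J)"
    using dg_expansion[OF Ks(1) _ _ te, of "[]" J] Ks by simp
  also have "\<dots> = (\<Sum>\<omega> | partition_on J \<omega>. (\<Prod>K\<in>\<omega>. te K) *\<^sub>R dg (filter (\<lambda>K. K \<in> \<omega>) Ks) (\<lambda>_. 0) J)"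
  proof (rule sum.mono_neutral_right)
    show "{\<omega>. partition_on J \<omega>} \<subseteq> Pow blocks" using partition_blocks[OF _ J] by auto
    show "\<forall>S\<in>Pow blocks - {\<omega>. partition_on J \<omega>}. (\<Prod>K\<in>S. te K) *\<^sub>R dg (filter (\<lambda>K. K \<in> S) Ks) (\<lambda>_. 0) J = 0"
    proof
      fix S assume S: "S \<in> Pow blocks - {\<omega>. partition_on J \<omega>}"
      then have "set (filter (\<lambda>K. K \<in> S) Ks) = S" using Ks(2) by auto
      then have "dg (filter (\<lambda>K. K \<in> S) Ks) (\<lambda>_. 0) J = 0"
        using S by (intro dg_zero_unless_partition) auto
      then show "(\<Prod>K\<in>S. te K) *\<^sub>R dg (filter (\<lambda>K. K \<in> S) Ks) (\<lambda>_. 0) J = 0" by simp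
    qed
  qed (simp add: finite_blocks)
  also have "\<dots> = \<epsilon> ^ card J *\<^sub>R (\<Sum>\<omega> | partition_on J \<omega>. dg (filter (\<lambda>K. K \<in> \<omega>) Ks) (\<lambda>_. 0) J)"
    unfolding scaleR_sum_right
  proof (rule sum.cong[OF refl])
    fix \<omega> assume "\<omega> \<in> {\<omega>. partition_on J \<omega>}"
    then have p: "partition_on J \<omega>" and "\<omega> \<subseteq> blocks" using partition_blocks[OF _ J] by auto
    then have "card (\<Union>\<omega>) = (\<Sum>K\<in>\<omega>. card K)"
      using finite_block by (intro card_Union_disjoint) (auto simp: partition_on_def)
    with p have "(\<Sum>K\<in>\<omega>. card K) = card J" by (simp add: partition_on_def)
    moreover have "(\<Prod>K\<in>\<omega>. te K) = \<epsilon> ^ (\<Sum>K\<in>\<omega>. card K)" by (simp add: te_def power_sum)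
    ultimately show "(\<Prod>K\<in>\<omega>. te K) *\<^sub>R dg (filter (\<lambda>K. K \<in> \<omega>) Ks) (\<lambda>_. 0) J
               = \<epsilon> ^ card J *\<^sub>R dg (filter (\<lambda>K. K \<in> \<omega>) Ks) (\<lambda>_. 0) J"
      by simp
  qed
  finally show ?thesis using \<epsilon>(1) by simp
qed

lemma partition_sum_eq_dg:
  assumes Ks: "distinct Ks" "set Ks = blocks" and I: "I \<in> blocks"
  shows "(\<Sum>\<omega> | partition_on I \<omega>. bder g (card \<omega>) (blockdirs x \<omega>) (comp0 x) J)
           = (if I = J then (\<Sum>\<omega> | partition_on J \<omega>. dg (filter (\<lambda>K. K \<in> \<omega>) Ks) (\<lambda>_. 0) J) else 0)"
proof -
  have "bder g (card \<omega>) (blockdirs x \<omega>) (comp0 x) J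
          = (if I = J then dg (filter (\<lambda>K. K \<in> \<omega>) Ks) (\<lambda>_. 0) J else 0)" if p: "partition_on I \<omega>" for \<omega>
  proof -
    have \<omega>: "\<omega> \<subseteq> blocks" using partition_blocks[OF p] I by (simp add: blocks_def)
    then have "set (filter (\<lambda>K. K \<in> \<omega>) Ks) = \<omega>" using Ks(2) by auto
    moreover have "I \<noteq> J \<Longrightarrow> \<not> partition_on J \<omega>" using p by (auto simp: partition_on_def)
    ultimately have "I \<noteq> J \<Longrightarrow> dg (filter (\<lambda>K. K \<in> \<omega>) Ks) (\<lambda>_. 0) J = 0"
      using \<omega> by (intro dg_zero_unless_partition) auto
    then show ?thesis using bder_blockdirs[OF Ks \<omega>] by simp
  qed
  then show ?thesis by (auto intro: sum.neutral)
qed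

lemma taylor_formula:
  "g x J = g (comp0 x) J +
     (\<Sum>I\<in>blocks. \<Sum>\<omega> | partition_on I \<omega>. bder g (card \<omega>) (blockdirs x \<omega>) (comp0 x) J)"
proof -
  obtain Ks where Ks: "distinct Ks" "set Ks = blocks" using finite_distinct_list[OF finite_blocks] by blast
  let ?S = "\<Sum>\<omega> | partition_on J \<omega>. dg (filter (\<lambda>K. K \<in> \<omega>) Ks) (\<lambda>_. 0) J"
  have g0: "g (comp0 x) J = dg [] (\<lambda>_. 0) J" by (simp add: dg_def param_zero)
  have "(\<Sum>I\<in>blocks. \<Sum>\<omega> | partition_on I \<omega>. bder g (card \<omega>) (blockdirs x \<omega>) (comp0 x) J)
          = (if J \<in> blocks then ?S else 0)"
    by (simp add: partition_sum_eq_dg[OF Ks] finite_blocks)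
  moreover consider "\<not> J \<subseteq> {1..n}" | "J = {}" | "J \<in> blocks" by (auto simp: blocks_def)
  then have "g x J = g (comp0 x) J + (if J \<in> blocks then ?S else 0)"
  proof cases
    case 1
    have "bar_scale n (\<lambda>_. 1) x = x" by (auto simp: bar_scale_def x_outside)
    then have "g x J = bar_scale n (\<lambda>_. 1) (g x) J" by (metis g_bar_scale[OF x_in_U])
    then show ?thesis using 1 g0 dg_outside[OF in_box_zero, of "[]" J] by (simp add: bar_scale_def blocks_def)
  next
    case 2
    then show ?thesis using g_partition_sum[OF Ks] g0 by (simp add: partition_on_empty blocks_def)
  next
    case 3
    then have "g (comp0 x) J = 0"
      using g0 dg_zero_unless_partition[of "[]" J] by (auto simp: partition_on_def blocks_def)
    with 3 show ?thesis using g_partition_sum[OF Ks] by (simp add: blocks_def)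
  qed
  ultimately show ?thesis by simp
qed

end

theorem mainTheorem4:
  fixes k :: enat
    and U :: "nat \<Rightarrow> (nat set \<Rightarrow> ('e0::{real_vector,t2_space}) \<times> ('e1::{real_vector,t2_space})) set"
    and f :: "nat \<Rightarrow> (nat set \<Rightarrow> 'e0 \<times> 'e1) \<Rightarrow> (nat set \<Rightarrow> ('f0::{real_vector,t2_space}) \<times> ('f1::{real_vector,t2_space}))"
    and n :: nat
    and x :: "nat set \<Rightarrow> 'e0 \<times> 'e1"
  assumes "lcs TYPE('e0)" and "lcs TYPE('e1)" and "lcs TYPE('f0)" and "lcs TYPE('f1)"
    and "open_subfunctor k U"
    and "nat_trans k U f"
    and "\<And>m. enat m \<le> k \<Longrightarrow> bsmooth (sbar m) (U m) (f m)"
    and "enat n \<le> k"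
    and "x \<in> U n"
  shows "f n x = (\<lambda>J. f n (comp0 x) J +
           (\<Sum>I\<in>Pow {1..n} - {{}}. \<Sum>\<omega>\<in>{\<omega>. partition_on I \<omega>}.
               bder (f n) (card \<omega>) (blockdirs x \<omega>) (comp0 x) J))"
proof -
  interpret scale_equivariant "f n" "U n" n x
  proof
    show "lcs TYPE('e0 \<times> 'e1)" "lcs TYPE('f0 \<times> 'f1)" using assms(1-4) by (simp_all add: lcs_prod)
    show "bsmooth (sbar n) (U n) (f n)" using assms(7,8) .
    show "openin (top_of_set (sbar n)) (U n)" using assms(5,8) by (simp add: open_subfunctor_def)
    show "x \<in> U n" by fact
    fix s y assume y: "y \<in> U n"
    have "barmap n (grass_scale s) ` U n \<subseteq> U n"
      using assms(5,8) ghom_grass_scale by (simp add: open_subfunctor_def)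
    with y show "bar_scale n s y \<in> U n" by (auto simp flip: barmap_grass_scale)
    show "f n (bar_scale n s y) = bar_scale n s (f n y)"
      using assms(6,8) y ghom_grass_scale[of n s] by (simp add: nat_trans_def flip: barmap_grass_scale)
  qed
  show ?thesis using taylor_formula by (simp add: blocks_def fun_eq_iff)
qed

end
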